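(* Let $G$ be a non-discrete totally disconnected, locally compact group, let $H$ be a compactly generated closed subgroup of $G$, and suppose there is a cocompact closed subgroup $K$ of $H$ such that $K$ is flat on $G$. Suppose that every compact open subgroup $U$ of $G$ is just infinite, that is, every non-trivial closed normal subgroup of $U$ has finite index. Then the following dichotomy holds: (a) If $H$ normalizes a compact open subgroup of $G$, then there is a base of neighbourhoods of the identity in $G$ consisting of compact open subgroups normalized by $H$; (b) If $H$ does not normalize any compact open subgroup of $G$, then $\mathrm{Res}_G(H)$ is the unique smallest open subgroup of $G$ normalized by $H$.
   Context: Topological groups are Hausdorff. For an automorphism $\alpha$ of $G$ (for $g\in G$, take $\alpha(x)=gxg^{-1}$) and a compact open subgroup $U$ of $G$, put $U_+ = \bigcap_{n\ge 0}\alpha^n(U)$, $U_-=\bigcap_{n\le 0}\alpha^n(U)$, $U_{++} = \{g \in G \mid \exists m\in\mathbb{Z}\ \forall n \le m:\ \alpha^n(g)\in U\}$. $U$ is tidy for $\alpha$ if $U=U_+U_-$ and $U_{++}$ is closed; equivalently, $|\alpha(U):\alpha(U)\cap U|$ is minimal among all compact open subgroups. A subgroup $K$ of $G$ is flat on $G$ if some compact open subgroup of $G$ is tidy for every element of $K$. $\mathrm{Res}_G(H)$ is the intersection of all open subgroups of $G$ normalized by $H$. *)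

theory Defs
  imports "HOL-Analysis.Analysis" "HOL-Algebra.Group_Action" "HOL-Algebra.Generated_Groups"
begin

locale topological_group = group G for G :: "('a, 'b) monoid_scheme" (structure) and T :: "'a topology" +
  assumes topspace_eq_carrier: "topspace T = carrier G"
    and continuous_mult: "continuous_map (prod_topology T T) T (\<lambda>(x, y). x \<otimes> y)"
    and continuous_inv: "continuous_map T T (\<lambda>x. inv x)"
    and Hausdorff: "Hausdorff_space T"

definition totally_disconnected_space :: "'a topology \<Rightarrow> bool" where
  "totally_disconnected_space X \<longleftrightarrow> (\<forall>S. connectedin X S \<longrightarrow> (\<exists>a. S \<subseteq> {a}))"

text \<open>The finest topology on the image of \<^term>\<open>f\<close> that makes \<^term>\<open>f\<close> continuous.\<close>

definition quotient_topology :: "'a topology \<Rightarrow> ('a \<Rightarrow> 'b) \<Rightarrow> 'b topology" where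
  "quotient_topology X f =
     topology (\<lambda>W. W \<subseteq> f ` topspace X \<and> openin X {x \<in> topspace X. f x \<in> W})"

lemma openin_quotient_topology:
  "openin (quotient_topology X f) W \<longleftrightarrow>
     W \<subseteq> f ` topspace X \<and> openin X {x \<in> topspace X. f x \<in> W}"
proof -
  let ?P = "\<lambda>W. {x \<in> topspace X. f x \<in> W}"
  have Int: "?P (S \<inter> R) = ?P S \<inter> ?P R" for S R
    by blast
  have Un: "?P (\<Union>\<K>) = \<Union>(?P ` \<K>)" for \<K>
    by blast
  have "openin X (\<Union>(?P ` \<K>))" if "\<forall>K\<in>\<K>. openin X (?P K)" for \<K>
    by (rule openin_Union) (use that in blast)
  then have "istopology (\<lambda>W. W \<subseteq> f ` topspace X \<and> openin X (?P W))"
    unfolding istopology_def Int Un by (simp add: openin_Int Sup_le_iff le_infI1)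
  then show ?thesis
    unfolding quotient_topology_def by (subst topology_inverse') simp_all
qed

lemma topspace_quotient_topology: "topspace (quotient_topology X f) = f ` topspace X"
proof
  show "topspace (quotient_topology X f) \<subseteq> f ` topspace X"
    using openin_topspace[of "quotient_topology X f"] by (simp only: openin_quotient_topology)
  have "{x \<in> topspace X. f x \<in> f ` topspace X} = topspace X"
    by auto
  then have "openin (quotient_topology X f) (f ` topspace X)"
    by (simp add: openin_quotient_topology)
  then show "f ` topspace X \<subseteq> topspace (quotient_topology X f)"
    by (rule openin_subset)
qed

lemma quotient_map_quotient_topology: "quotient_map X (quotient_topology X f) f"
  by (simp add: quotient_map_def topspace_quotient_topology openin_quotient_topology)

definition coset_space :: "('a, 'b) monoid_scheme \<Rightarrow> 'a topology \<Rightarrow> 'a set \<Rightarrow> 'a set \<Rightarrow> 'a set topology"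
  where "coset_space G T H K = quotient_topology (subtopology T H) (\<lambda>h. h <#\<^bsub>G\<^esub> K)"

definition closed_subgroup :: "('a, 'b) monoid_scheme \<Rightarrow> 'a topology \<Rightarrow> 'a set \<Rightarrow> bool" where
  "closed_subgroup G T H \<longleftrightarrow> subgroup H G \<and> closedin T H"

definition open_subgroup :: "('a, 'b) monoid_scheme \<Rightarrow> 'a topology \<Rightarrow> 'a set \<Rightarrow> bool" where
  "open_subgroup G T U \<longleftrightarrow> subgroup U G \<and> openin T U"

definition compact_open_subgroup :: "('a, 'b) monoid_scheme \<Rightarrow> 'a topology \<Rightarrow> 'a set \<Rightarrow> bool" where
  "compact_open_subgroup G T U \<longleftrightarrow> subgroup U G \<and> compactin T U \<and> openin T U"

definition compactly_generated :: "('a, 'b) monoid_scheme \<Rightarrow> 'a topology \<Rightarrow> 'a set \<Rightarrow> bool" where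
  "compactly_generated G T H \<longleftrightarrow> (\<exists>S. S \<subseteq> H \<and> compactin T S \<and> generate G S = H)"

definition cocompact_closed_subgroup ::
  "('a, 'b) monoid_scheme \<Rightarrow> 'a topology \<Rightarrow> 'a set \<Rightarrow> 'a set \<Rightarrow> bool" where
  "cocompact_closed_subgroup G T H K \<longleftrightarrow>
     closed_subgroup (G\<lparr>carrier := H\<rparr>) (subtopology T H) K \<and> compact_space (coset_space G T H K)"

definition normalized_by :: "('a, 'b) monoid_scheme \<Rightarrow> 'a set \<Rightarrow> 'a set \<Rightarrow> bool" where
  "normalized_by G H U \<longleftrightarrow> H \<subseteq> normalizer G U"

text \<open>The requirement that \<^term>\<open>U\<close> be infinite is not imposed.\<close>

definition just_infinite :: "('a, 'b) monoid_scheme \<Rightarrow> 'a topology \<Rightarrow> 'a set \<Rightarrow> bool" where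
  "just_infinite G T U \<longleftrightarrow>
     (\<forall>N. N \<lhd> G\<lparr>carrier := U\<rparr> \<and> closedin (subtopology T U) N \<and> N \<noteq> {\<one>\<^bsub>G\<^esub>}
        \<longrightarrow> finite (rcosets\<^bsub>G\<lparr>carrier := U\<rparr>\<^esub> N))"

text \<open>Automorphisms are elements of \<^const>\<open>AutoGroup\<close>, hence extensional functions on the
  carrier; integer powers are taken in that group.\<close>

definition inner_aut :: "('a, 'b) monoid_scheme \<Rightarrow> 'a \<Rightarrow> 'a \<Rightarrow> 'a" where
  "inner_aut G g = (\<lambda>x\<in>carrier G. g \<otimes>\<^bsub>G\<^esub> x \<otimes>\<^bsub>G\<^esub> inv\<^bsub>G\<^esub> g)"

lemma (in group) inner_aut_in_AutoGroup:
  assumes g: "g \<in> carrier G"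
  shows "inner_aut G g \<in> carrier (AutoGroup G)"
proof -
  have "inner_aut G g \<in> hom G G"
  proof (rule homI)
    fix x y
    assume x: "x \<in> carrier G" and y: "y \<in> carrier G"
    have "(g \<otimes> x \<otimes> inv g) \<otimes> (g \<otimes> y \<otimes> inv g) = g \<otimes> x \<otimes> ((inv g \<otimes> g) \<otimes> (y \<otimes> inv g))"
      using g x y by (simp only: m_assoc m_closed inv_closed)
    also have "\<dots> = g \<otimes> (x \<otimes> y) \<otimes> inv g"
      using g x y by (simp add: m_assoc)
    finally show "inner_aut G g (x \<otimes> y) = inner_aut G g x \<otimes> inner_aut G g y"
      using x y by (simp add: inner_aut_def)
  qed (use g in \<open>simp add: inner_aut_def\<close>)
  moreover have "inner_aut G g \<in> Bij (carrier G)"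
    using conjugation_is_bij[OF g] by (simp add: Bij_def inner_aut_def)
  ultimately show ?thesis
    by (simp add: AutoGroup_def auto_def)
qed

definition tidy_plus :: "('a, 'b) monoid_scheme \<Rightarrow> ('a \<Rightarrow> 'a) \<Rightarrow> 'a set \<Rightarrow> 'a set" where
  "tidy_plus G \<alpha> U = (\<Inter>n\<in>{n::int. n \<ge> 0}. (\<alpha> [^]\<^bsub>AutoGroup G\<^esub> n) ` U)"

definition tidy_minus :: "('a, 'b) monoid_scheme \<Rightarrow> ('a \<Rightarrow> 'a) \<Rightarrow> 'a set \<Rightarrow> 'a set" where
  "tidy_minus G \<alpha> U = (\<Inter>n\<in>{n::int. n \<le> 0}. (\<alpha> [^]\<^bsub>AutoGroup G\<^esub> n) ` U)"

definition tidy_plusplus :: "('a, 'b) monoid_scheme \<Rightarrow> ('a \<Rightarrow> 'a) \<Rightarrow> 'a set \<Rightarrow> 'a set" where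
  "tidy_plusplus G \<alpha> U =
     {g \<in> carrier G. \<exists>m::int. \<forall>n\<le>m. (\<alpha> [^]\<^bsub>AutoGroup G\<^esub> n) g \<in> U}"

definition tidy :: "('a, 'b) monoid_scheme \<Rightarrow> 'a topology \<Rightarrow> ('a \<Rightarrow> 'a) \<Rightarrow> 'a set \<Rightarrow> bool" where
  "tidy G T \<alpha> U \<longleftrightarrow>
     U = tidy_plus G \<alpha> U <#>\<^bsub>G\<^esub> tidy_minus G \<alpha> U \<and> closedin T (tidy_plusplus G \<alpha> U)"

definition flat_on :: "('a, 'b) monoid_scheme \<Rightarrow> 'a topology \<Rightarrow> 'a set \<Rightarrow> bool" where
  "flat_on G T K \<longleftrightarrow>
     subgroup K G \<and> (\<exists>U. compact_open_subgroup G T U \<and> (\<forall>g\<in>K. tidy G T (inner_aut G g) U))"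

definition Res :: "('a, 'b) monoid_scheme \<Rightarrow> 'a topology \<Rightarrow> 'a set \<Rightarrow> 'a set" where
  "Res G T H = \<Inter>{V. open_subgroup G T V \<and> normalized_by G H V}"

text \<open>\<^term>\<open>R\<close> is smallest with respect to inclusion, i.e. it is a least element and not merely a
  minimal one.\<close>

definition smallest_open_normalized ::
  "('a, 'b) monoid_scheme \<Rightarrow> 'a topology \<Rightarrow> 'a set \<Rightarrow> 'a set \<Rightarrow> bool" where
  "smallest_open_normalized G T H R \<longleftrightarrow>
     open_subgroup G T R \<and> normalized_by G H R \<and>
     (\<forall>V. open_subgroup G T V \<and> normalized_by G H V \<longrightarrow> R \<subseteq> V)"

end

theory Submission
  imports Defs "HOL-Algebra.Elementary_Groups" "HOL-Algebra.SndIsomorphismGrp"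
    "HOL-Algebra.Multiplicative_Group"
begin

text \<open>
  (a) Let \<open>R\<close> be the intersection of all open subgroups of \<open>U\<close> normalized by \<open>HU\<close>. If \<open>R\<close> is trivial,
  compactness gives the base of neighbourhoods. Otherwise \<open>R\<close> is open by just-infiniteness and has
  no proper open subgroup normalized by \<open>HU\<close>. This is impossible, since an infinite compact
  totally disconnected just infinite group has a proper open characteristic subgroup: either the
  intersection of all maximal open normal subgroups, or, if that is trivial, a suitable subgroup of
  \<open>n\<close>-th powers or an intersection of open normal subgroups with abelian quotient.

  (b) If the tidy subgroup \<open>U\<close> were normalized by \<open>K\<close>, it would have finitely many \<open>H\<close>-conjugates by
  cocompactness, and their intersection would be normalized by \<open>H\<close>. So some \<open>k \<in> K\<close> moves \<open>U\<close>. With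
  \<open>U\<^sub>0 = \<Inter>n. k^n U k^-n\<close>, every open \<open>k\<close>-invariant subgroup \<open>V\<close> satisfies \<open>U\<^sub>+ \<union> U\<^sub>- \<subseteq> V U\<^sub>0\<close>, because
  conjugation by powers of \<open>k\<close> contracts \<open>U\<^sub>+\<close> and \<open>U\<^sub>-\<close> towards \<open>U\<^sub>0\<close>. It follows that \<open>U \<subseteq> R U\<^sub>0\<close>, where
  \<open>R\<close> is the intersection of all open subgroups normalized by \<open>k\<close> and \<open>U\<^sub>0\<close>. Hence \<open>U\<close> normalizes \<open>R\<close>, and
  \<open>R \<inter> U\<close> is a non-trivial closed normal subgroup of \<open>U\<close>, so \<open>R\<close> is open. Every open subgroup
  normalized by \<open>H\<close> contains an open one normalized by \<open>k\<close> and \<open>U\<^sub>0\<close>, hence \<open>R\<close>.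
\<close>

no_notation (input) Multiset.subset_mset (infix "<#" 50)

section \<open>Inner automorphisms and open subgroups\<close>

context group
begin

lemma inner_aut_apply: "x \<in> carrier G \<Longrightarrow> inner_aut G g x = g \<otimes> x \<otimes> inv g"
  by (simp add: inner_aut_def)

lemma inner_aut_closed:
  "\<lbrakk>g \<in> carrier G; x \<in> carrier G\<rbrakk> \<Longrightarrow> inner_aut G g x \<in> carrier G"
  by (simp add: inner_aut_apply)

lemma inner_aut_mult:
  "\<lbrakk>g \<in> carrier G; h \<in> carrier G; x \<in> carrier G\<rbrakk>
    \<Longrightarrow> inner_aut G (g \<otimes> h) x = inner_aut G g (inner_aut G h x)"
  by (simp add: inner_aut_apply inv_mult_group m_assoc)

lemma inner_aut_one: "x \<in> carrier G \<Longrightarrow> inner_aut G \<one> x = x"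
  by (simp add: inner_aut_apply)

lemma inner_aut_inv_cancel:
  assumes "g \<in> carrier G" "x \<in> carrier G"
  shows "inner_aut G g (inner_aut G (inv g) x) = x" "inner_aut G (inv g) (inner_aut G g x) = x"
  using assms by (simp_all add: inner_aut_mult [symmetric] inner_aut_one)

lemma inner_aut_hom: "g \<in> carrier G \<Longrightarrow> inner_aut G g \<in> hom G G"
  using inner_aut_in_AutoGroup by (simp add: AutoGroup_def auto_def)

lemma inj_on_inner_aut: "g \<in> carrier G \<Longrightarrow> inj_on (inner_aut G g) (carrier G)"
  by (rule inj_on_inverseI [where g = "inner_aut G (inv g)"]) (rule inner_aut_inv_cancel(2))

lemma inner_aut_image_subset:
  "\<lbrakk>g \<in> carrier G; A \<subseteq> carrier G\<rbrakk> \<Longrightarrow> inner_aut G g ` A \<subseteq> carrier G"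
  using inner_aut_closed by blast

lemma inner_aut_image_mult:
  "\<lbrakk>g \<in> carrier G; h \<in> carrier G; A \<subseteq> carrier G\<rbrakk>
    \<Longrightarrow> inner_aut G (g \<otimes> h) ` A = inner_aut G g ` inner_aut G h ` A"
  by (auto simp: image_image inner_aut_mult subset_iff intro!: image_cong)

lemma inner_aut_image_one: "A \<subseteq> carrier G \<Longrightarrow> inner_aut G \<one> ` A = A"
  by (force simp: inner_aut_one subset_iff image_iff)

lemma inner_aut_image_eq_inv:
  assumes "g \<in> carrier G" "A \<subseteq> carrier G" "inner_aut G g ` A = A"
  shows "inner_aut G (inv g) ` A = A"
  using assms inner_aut_image_mult [of "inv g" g A] inner_aut_image_one [of A] by simp

lemma inner_aut_image_iff:
  assumes "g \<in> carrier G" "A \<subseteq> carrier G" "x \<in> carrier G"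
  shows "x \<in> inner_aut G g ` A \<longleftrightarrow> inner_aut G (inv g) x \<in> A"
proof
  assume "x \<in> inner_aut G g ` A"
  then obtain a where "a \<in> A" "x = inner_aut G g a"
    by auto
  then show "inner_aut G (inv g) x \<in> A"
    using assms(1,2) by (simp add: subset_iff inner_aut_inv_cancel(2))
next
  assume "inner_aut G (inv g) x \<in> A"
  then have "inner_aut G g (inner_aut G (inv g) x) \<in> inner_aut G g ` A"
    by (rule imageI)
  then show "x \<in> inner_aut G g ` A"
    using assms by (simp add: inner_aut_inv_cancel(1))
qed

text \<open>A conjugation may map a set strictly into itself, so the inclusion for \<open>g\<close>
  alone is not enough; the one for \<open>inv g\<close> gives the reverse inclusion after applying
  conjugation by \<open>g\<close>.\<close>

lemma inner_aut_image_fixI: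
  assumes "g \<in> carrier G" "A \<subseteq> carrier G" "inner_aut G g ` A \<subseteq> A" "inner_aut G (inv g) ` A \<subseteq> A"
  shows "inner_aut G g ` A = A"
proof
  show "A \<subseteq> inner_aut G g ` A"
  proof
    fix x assume "x \<in> A"
    with assms(2,4) show "x \<in> inner_aut G g ` A"
      by (subst inner_aut_image_iff [OF assms(1,2)]) auto
  qed
qed (rule assms(3))

lemma inner_aut_image_self:
  assumes "subgroup A G" "a \<in> A"
  shows "inner_aut G a ` A = A"
proof (rule inner_aut_image_fixI)
  interpret subgroup A G by fact
  show "a \<in> carrier G" "A \<subseteq> carrier G" "inner_aut G a ` A \<subseteq> A" "inner_aut G (inv a) ` A \<subseteq> A"
    using assms(2) by (auto simp: inner_aut_apply)
qed

lemma subgroup_inner_aut_image: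
  assumes "g \<in> carrier G" "subgroup A G"
  shows "subgroup (inner_aut G g ` A) G"
proof -
  interpret group_hom G G "inner_aut G g"
    by unfold_locales (simp add: inner_aut_hom assms)
  show ?thesis
    using subgroup_img_is_subgroup assms by blast
qed

text \<open>The bridge to \<open>normalizer\<close>, which is defined through two-sided translates
  instead of images under conjugation.\<close>

lemma inner_aut_image_eq_coset: "A \<subseteq> carrier G \<Longrightarrow> inner_aut G g ` A = g <# A #> inv g"
  by (auto simp: l_coset_def r_coset_def inner_aut_apply subset_iff image_iff)

lemma mem_normalizer_iff:
  assumes "A \<subseteq> carrier G"
  shows "g \<in> normalizer G A \<longleftrightarrow> g \<in> carrier G \<and> inner_aut G g ` A = A"
  using assms by (auto simp: normalizer_def stabilizer_def inner_aut_image_eq_coset)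

lemma normalized_by_iff:
  assumes "A \<subseteq> carrier G"
  shows "normalized_by G H A \<longleftrightarrow> H \<subseteq> carrier G \<and> (\<forall>h\<in>H. inner_aut G h ` A = A)"
  unfolding normalized_by_def subset_iff mem_normalizer_iff [OF assms] by blast

lemma inner_aut_image_Inter:
  assumes "g \<in> carrier G" "I \<noteq> {}" "\<And>i. i \<in> I \<Longrightarrow> A i \<subseteq> carrier G"
  shows "inner_aut G g ` (\<Inter>i\<in>I. A i) = (\<Inter>i\<in>I. inner_aut G g ` A i)"
proof -
  obtain j where "j \<in> I"
    using assms(2) by auto
  then show ?thesis
    using assms(3) by (intro image_INT [OF inj_on_inner_aut [OF assms(1)]]) auto
qed

lemma inner_aut_image_Int:
  assumes "g \<in> carrier G" "A \<subseteq> carrier G" "B \<subseteq> carrier G"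
  shows "inner_aut G g ` (A \<inter> B) = inner_aut G g ` A \<inter> inner_aut G g ` B"
  by (rule inj_on_image_Int [OF inj_on_inner_aut [OF assms(1)] assms(2,3)])

lemma inner_aut_image_set_mult:
  assumes "g \<in> carrier G" "A \<subseteq> carrier G" "B \<subseteq> carrier G"
  shows "inner_aut G g ` (A <#> B) = inner_aut G g ` A <#> inner_aut G g ` B"
proof -
  have "inner_aut G g (a \<otimes> b) = inner_aut G g a \<otimes> inner_aut G g b" if "a \<in> A" "b \<in> B" for a b
    using that assms hom_mult [OF inner_aut_hom [OF assms(1)]] by auto
  then show ?thesis
    by (auto simp: set_mult_def image_UN)
qed

text \<open>Conjugation is a homomorphism from \<open>G\<close> to \<open>AutoGroup G\<close> and
  therefore respects integer powers. This turns the powers of automorphisms in the definition of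
  tidiness into conjugations by powers of \<open>g\<close>.\<close>

lemma inner_aut_int_pow:
  assumes "g \<in> carrier G"
  shows "inner_aut G g [^]\<^bsub>AutoGroup G\<^esub> (n::int) = inner_aut G (g [^] n)"
proof -
  interpret A: group "AutoGroup G" by (rule AutoGroup)
  have "inner_aut G x \<in> Bij (carrier G)" if "x \<in> carrier G" for x
    using inner_aut_in_AutoGroup [OF that] by (simp add: AutoGroup_def auto_def)
  then have "inner_aut G \<in> hom G (AutoGroup G)"
    by (intro homI inner_aut_in_AutoGroup)
      (auto simp: AutoGroup_def BijGroup_def compose_def fun_eq_iff
         inner_aut_mult [symmetric] inner_aut_def [of _ "_ \<otimes> _"])
  then interpret group_hom G "AutoGroup G" "inner_aut G"
    by unfold_locales
  show ?thesis
    using hom_int_pow [OF assms] by simp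
qed

text \<open>Intersecting with the carrier covers the empty family as well, whose bare intersection
  would be the whole type.\<close>

lemma subgroup_Inter_carrier:
  assumes "\<And>V. V \<in> F \<Longrightarrow> subgroup V G"
  shows "subgroup (carrier G \<inter> \<Inter>F) G"
  by (rule subgroup.intro)
    (auto dest: assms intro: subgroup.one_closed subgroup.m_closed subgroup.m_inv_closed)

end

section \<open>Translations, conjugations and open subgroups of a topological group\<close>

context topological_group
begin

lemma openin_subset_carrier: "openin T A \<Longrightarrow> A \<subseteq> carrier G"
  using openin_subset topspace_eq_carrier by blast

lemma continuous_map_times:
  assumes "continuous_map X T f" "continuous_map X T g"
  shows "continuous_map X T (\<lambda>x. f x \<otimes> g x)"
proof -
  have "continuous_map X T ((\<lambda>(x, y). x \<otimes> y) \<circ> (\<lambda>x. (f x, g x)))"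
    using assms by (intro continuous_map_compose [OF _ continuous_mult]) (simp add: continuous_map_paired)
  then show ?thesis
    by (simp add: o_def)
qed

lemma continuous_map_left_mult: "g \<in> carrier G \<Longrightarrow> continuous_map T T (\<lambda>x. g \<otimes> x)"
  by (intro continuous_map_times) (auto simp: topspace_eq_carrier)

lemma continuous_map_right_mult: "g \<in> carrier G \<Longrightarrow> continuous_map T T (\<lambda>x. x \<otimes> g)"
  by (intro continuous_map_times) (auto simp: topspace_eq_carrier)

lemma homeomorphic_map_left_mult: "g \<in> carrier G \<Longrightarrow> homeomorphic_map T T (\<lambda>x. g \<otimes> x)"
  by (rule homeomorphic_maps_imp_map [where g = "\<lambda>x. inv g \<otimes> x"])
    (auto simp: homeomorphic_maps_def continuous_map_left_mult topspace_eq_carrier m_assoc [symmetric])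

lemma homeomorphic_map_right_mult: "g \<in> carrier G \<Longrightarrow> homeomorphic_map T T (\<lambda>x. x \<otimes> g)"
  by (rule homeomorphic_maps_imp_map [where g = "\<lambda>x. x \<otimes> inv g"])
    (auto simp: homeomorphic_maps_def continuous_map_right_mult topspace_eq_carrier m_assoc)

lemma homeomorphic_map_inner_aut:
  assumes "g \<in> carrier G"
  shows "homeomorphic_map T T (inner_aut G g)"
proof -
  have "homeomorphic_map T T ((\<lambda>x. x \<otimes> inv g) \<circ> (\<lambda>x. g \<otimes> x))"
    using assms
    by (intro homeomorphic_map_compose [of T T _ T] homeomorphic_map_left_mult homeomorphic_map_right_mult) auto
  then show ?thesis
    by (rule homeomorphic_map_eq) (simp add: inner_aut_apply topspace_eq_carrier)
qed

lemma openin_l_coset: "\<lbrakk>g \<in> carrier G; openin T A\<rbrakk> \<Longrightarrow> openin T (g <# A)"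
  using homeomorphic_imp_open_map [OF homeomorphic_map_left_mult]
  by (auto simp: l_coset_def open_map_def UNION_singleton_eq_range)

lemma openin_r_coset: "\<lbrakk>g \<in> carrier G; openin T A\<rbrakk> \<Longrightarrow> openin T (A #> g)"
  using homeomorphic_imp_open_map [OF homeomorphic_map_right_mult]
  by (auto simp: r_coset_def open_map_def UNION_singleton_eq_range)

lemma closedin_l_coset: "\<lbrakk>g \<in> carrier G; closedin T A\<rbrakk> \<Longrightarrow> closedin T (g <# A)"
  using homeomorphic_imp_closed_map [OF homeomorphic_map_left_mult]
  by (auto simp: l_coset_def closed_map_def UNION_singleton_eq_range)

lemma closedin_r_coset: "\<lbrakk>g \<in> carrier G; closedin T A\<rbrakk> \<Longrightarrow> closedin T (A #> g)"
  using homeomorphic_imp_closed_map [OF homeomorphic_map_right_mult]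
  by (auto simp: r_coset_def closed_map_def UNION_singleton_eq_range)

lemma openin_set_mult:
  assumes "A \<subseteq> carrier G" "openin T B"
  shows "openin T (A <#> B)" "openin T (B <#> A)"
proof -
  have eq: "A <#> B = (\<Union>a\<in>A. a <# B)" "B <#> A = (\<Union>a\<in>A. B #> a)"
    by (auto simp: set_mult_def l_coset_def r_coset_def)
  show "openin T (A <#> B)" "openin T (B <#> A)"
    unfolding eq using assms by (auto intro!: openin_l_coset openin_r_coset)
qed

lemma openin_inner_aut_image: "\<lbrakk>g \<in> carrier G; openin T A\<rbrakk> \<Longrightarrow> openin T (inner_aut G g ` A)"
  using homeomorphic_imp_open_map [OF homeomorphic_map_inner_aut] by (auto simp: open_map_def)

lemma open_subgroup_inner_aut_image:
  "\<lbrakk>g \<in> carrier G; open_subgroup G T A\<rbrakk> \<Longrightarrow> open_subgroup G T (inner_aut G g ` A)"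
  by (simp add: open_subgroup_def subgroup_inner_aut_image openin_inner_aut_image)

text \<open>The subgroup is the union of the translates \<open>a <# B\<close> for \<open>a\<close>
  in \<open>A\<close>, all of which are open.\<close>

lemma open_subgroupI:
  assumes "subgroup A G" "openin T B" "\<one> \<in> B" "B \<subseteq> A"
  shows "open_subgroup G T A"
proof -
  have A: "A \<subseteq> carrier G"
    using assms(1) by (rule subgroup.subset)
  have "A <#> B = A"
  proof
    show "A <#> B \<subseteq> A"
      using assms subgroup.m_closed by (fastforce simp: set_mult_def)
    show "A \<subseteq> A <#> B"
      using assms(3) A by (force simp: set_mult_def)
  qed
  then show ?thesis
    using openin_set_mult(1) [OF A assms(2)] assms(1) by (simp add: open_subgroup_def)
qed

text \<open>The complement is stable under right multiplication by \<open>A\<close>, hence a union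
  of open left cosets.\<close>

lemma closedin_open_subgroup:
  assumes "open_subgroup G T A"
  shows "closedin T A"
proof -
  interpret subgroup A G
    using assms by (simp add: open_subgroup_def)
  have "carrier G - A = (carrier G - A) <#> A"
  proof
    have "x = x \<otimes> \<one>" if "x \<in> carrier G" for x
      using that by simp
    then show "carrier G - A \<subseteq> (carrier G - A) <#> A"
      unfolding set_mult_def using one_closed by blast
    have "x \<otimes> a \<notin> A" if "x \<in> carrier G - A" "a \<in> A" for x a
    proof
      assume "x \<otimes> a \<in> A"
      then have "x \<otimes> a \<otimes> inv a \<in> A"
        using subgroup.m_closed subgroup.m_inv_closed subgroup_axioms that(2) by metis
      moreover have "x \<otimes> a \<otimes> inv a = x"
        using that by (simp add: m_assoc)
      ultimately show False
        using that(1) by simp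
    qed
    then show "(carrier G - A) <#> A \<subseteq> carrier G - A"
      by (auto simp: set_mult_def)
  qed
  then have "openin T (carrier G - A)"
    using openin_set_mult(1) assms by (metis Diff_subset open_subgroup_def)
  then show ?thesis
    using subset by (simp add: closedin_def topspace_eq_carrier)
qed

lemma open_subgroup_Int:
  "\<lbrakk>open_subgroup G T A; open_subgroup G T B\<rbrakk> \<Longrightarrow> open_subgroup G T (A \<inter> B)"
  by (simp add: open_subgroup_def subgroups_Inter_pair openin_Int)

lemma open_subgroup_finite_Inter:
  assumes "finite F" "F \<noteq> {}" "\<And>V. V \<in> F \<Longrightarrow> open_subgroup G T V"
  shows "open_subgroup G T (\<Inter>F)"
  using assms by (induction F rule: finite_ne_induct) (auto intro!: open_subgroup_Int)

lemma compact_open_imp_open_subgroup: "compact_open_subgroup G T A \<Longrightarrow> open_subgroup G T A"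
  by (simp add: compact_open_subgroup_def open_subgroup_def)

lemma compact_open_subgroup_Int:
  assumes "compact_open_subgroup G T A" "open_subgroup G T B"
  shows "compact_open_subgroup G T (A \<inter> B)"
  using assms closedin_open_subgroup [OF assms(2)] compact_Int_closedin
  by (auto simp: compact_open_subgroup_def open_subgroup_def subgroups_Inter_pair openin_Int)

lemma compact_open_subgroup_open:
  assumes "compact_open_subgroup G T A" "open_subgroup G T B" "B \<subseteq> A"
  shows "compact_open_subgroup G T B"
  using compact_open_subgroup_Int [OF assms(1,2)] assms(3) by (simp add: Int_absorb1)

text \<open>The conjugate of \<open>V\<close> by \<open>c\<close> depends only on the coset
  \<open>c <# V\<close>, because \<open>V\<close> normalizes itself, and finitely many of these open
  cosets cover the compact set \<open>C\<close>.\<close>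

lemma finite_inner_aut_images:
  assumes "compactin T C" "open_subgroup G T V"
  shows "finite ((\<lambda>c. inner_aut G c ` V) ` C)"
proof -
  interpret subgroup V G
    using assms by (simp add: open_subgroup_def)
  have C: "C \<subseteq> carrier G"
    using assms(1) compactin_subset_topspace topspace_eq_carrier by blast
  have mem: "c \<in> c <# V" if "c \<in> C" for c
    using that C by (force simp: l_coset_def)
  have "openin T A" if "A \<in> (\<lambda>c. c <# V) ` C" for A
    using that C assms(2) openin_l_coset by (auto simp: open_subgroup_def)
  moreover have "C \<subseteq> \<Union>((\<lambda>c. c <# V) ` C)"
    using mem by blast
  ultimately obtain F where F: "finite F" "F \<subseteq> (\<lambda>c. c <# V) ` C" "C \<subseteq> \<Union>F"
    using compactinD [OF assms(1)] by meson
  obtain D where D: "finite D" "D \<subseteq> C" "F = (\<lambda>c. c <# V) ` D"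
    using finite_subset_image [OF F(1,2)] by blast
  have "(\<lambda>c. inner_aut G c ` V) ` C \<subseteq> (\<lambda>c. inner_aut G c ` V) ` D"
  proof clarify
    fix c assume c: "c \<in> C"
    then obtain d v where d: "d \<in> D" "v \<in> V" "c = d \<otimes> v"
      using F(3) D(3) by (auto simp: l_coset_def)
    then have "d \<in> carrier G" "v \<in> carrier G"
      using C D(2) by auto
    then have "inner_aut G c ` V = inner_aut G d ` V"
      using inner_aut_image_mult [of d v V] inner_aut_image_self [OF subgroup_axioms d(2)] d(3) subset
      by simp
    then show "inner_aut G c ` V \<in> (\<lambda>c. inner_aut G c ` V) ` D"
      using d(1) by blast
  qed
  then show ?thesis
    by (rule finite_surj [OF D(1)])
qed

lemma compact_finite_rcosets:
  assumes "compact_space T" "open_subgroup G T V"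
  shows "finite (rcosets V)"
proof -
  interpret subgroup V G
    using assms by (simp add: open_subgroup_def)
  have "openin T A" if "A \<in> rcosets V" for A
    using that assms(2) by (auto simp: RCOSETS_def open_subgroup_def intro!: openin_r_coset)
  moreover have "\<Union>(rcosets V) = topspace T"
    using rcosets_part_G [OF subgroup_axioms] topspace_eq_carrier by simp
  ultimately obtain F where F: "finite F" "F \<subseteq> rcosets V" "topspace T \<subseteq> \<Union>F"
    using compactinD [OF assms(1) [unfolded compact_space_def], of "rcosets V"] by force
  \<comment> \<open>Cosets are nonempty and pairwise disjoint, so a subcover cannot omit any of
    them.\<close>
  have "rcosets V \<subseteq> F"
  proof
    fix A assume A: "A \<in> rcosets V"
    then obtain x where "x \<in> A"
      using rcosets_non_empty [OF A] by auto
    moreover have "x \<in> topspace T"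
      using calculation rcosets_carrier [OF group_axioms A] topspace_eq_carrier by auto
    ultimately obtain B where "B \<in> F" "x \<in> B"
      using F by blast
    moreover have "A = B"
      using calculation F(2) A \<open>x \<in> A\<close> rcos_disjoint [OF subgroup_axioms]
      by (meson disjnt_iff pairwiseD subsetD)
    ultimately show "A \<in> F"
      by simp
  qed
  then show ?thesis
    by (rule finite_subset [OF _ F(1)])
qed

text \<open>The complement is the union of the remaining cosets, finitely many closed sets.\<close>

lemma openin_closed_finite_index:
  assumes "subgroup N G" "closedin T N" "finite (rcosets N)"
  shows "openin T N"
proof -
  interpret subgroup N G by fact
  have "carrier G - N = \<Union>(rcosets N - {N})"
    using rcosets_part_G [OF assms(1)] rcos_disjoint [OF assms(1)] subgroup_in_rcosets [OF group_axioms]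
    by (auto simp: pairwise_def disjnt_def)
  moreover have "closedin T (\<Union>(rcosets N - {N}))"
    using assms closedin_r_coset by (intro closedin_Union) (auto simp: RCOSETS_def)
  ultimately have "closedin T (topspace T - N)"
    by (simp add: topspace_eq_carrier)
  then show ?thesis
    using topspace_eq_carrier subset by (metis openin_closedin_eq)
qed

lemma topological_group_subgroup:
  assumes "subgroup A G"
  shows "topological_group (G\<lparr>carrier := A\<rparr>) (subtopology T A)"
proof -
  interpret A: subgroup A G by fact
  interpret GA: group "G\<lparr>carrier := A\<rparr>"
    by (rule A.subgroup_is_group [OF group_axioms])
  show ?thesis
  proof
    show "topspace (subtopology T A) = carrier (G\<lparr>carrier := A\<rparr>)"
      using A.subset by (auto simp: topspace_eq_carrier)
    show "continuous_map (prod_topology (subtopology T A) (subtopology T A)) (subtopology T A)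
        (\<lambda>(x, y). x \<otimes>\<^bsub>G\<lparr>carrier := A\<rparr>\<^esub> y)"
      using continuous_map_from_subtopology [OF continuous_mult, of "A \<times> A"] A.subset
      by (auto simp: continuous_map_in_subtopology subtopology_Times [symmetric] topspace_eq_carrier)
    have "continuous_map (subtopology T A) (subtopology T A) (\<lambda>x. inv x)"
      using continuous_map_from_subtopology [OF continuous_inv, of A]
      by (auto simp: continuous_map_in_subtopology)
    then show "continuous_map (subtopology T A) (subtopology T A) (\<lambda>x. inv\<^bsub>G\<lparr>carrier := A\<rparr>\<^esub> x)"
      by (rule continuous_map_eq) (simp add: m_inv_consistent [OF assms])
    show "Hausdorff_space (subtopology T A)"
      using Hausdorff Hausdorff_space_subtopology by blast
  qed
qed

end

section \<open>Open characteristic subgroups of just infinite groups\<close>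

text \<open>\<open>W\<close> together with the complements of the members of the family covers
  \<open>C\<close>; the complements that occur in a finite subcover give the finite
  subfamily.\<close>

lemma compactin_Inter_subset_open:
  assumes "compactin X C" "\<And>F. F \<in> \<F> \<Longrightarrow> closedin X F" "openin X W" "C \<inter> \<Inter>\<F> \<subseteq> W"
  obtains \<G> where "finite \<G>" "\<G> \<subseteq> \<F>" "C \<inter> \<Inter>\<G> \<subseteq> W"
proof -
  let ?cover = "insert W ((\<lambda>F. topspace X - F) ` \<F>)"
  have "openin X A" if "A \<in> ?cover" for A
    using that assms(2,3) by auto
  moreover have "C \<subseteq> \<Union>?cover"
    using assms(4) compactin_subset_topspace [OF assms(1)] by blast
  ultimately obtain \<H> where \<H>: "finite \<H>" "\<H> \<subseteq> ?cover" "C \<subseteq> \<Union>\<H>"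
    using compactinD [OF assms(1)] by meson
  have "\<H> - {W} \<subseteq> (\<lambda>F. topspace X - F) ` \<F>"
    using \<H>(2) by auto
  then obtain \<G> where \<G>: "finite \<G>" "\<G> \<subseteq> \<F>" "\<H> - {W} = (\<lambda>F. topspace X - F) ` \<G>"
    using finite_subset_image [of "\<H> - {W}"] \<H>(1) by (metis finite_Diff)
  have "x \<in> W" if x: "x \<in> C \<inter> \<Inter>\<G>" for x
  proof (rule ccontr)
    assume "x \<notin> W"
    then have "x \<in> \<Union>(\<H> - {W})"
      using x \<H>(3) by auto
    then show False
      using x \<G>(3) by auto
  qed
  then have "C \<inter> \<Inter>\<G> \<subseteq> W"
    by blast
  with \<G>(1,2) show thesis
    by (rule that)
qed

lemma finite_Inter_directed:
  assumes "finite \<G>" "\<G> \<subseteq> \<F>" "\<F> \<noteq> {}"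
    and "\<And>A B. \<lbrakk>A \<in> \<F>; B \<in> \<F>\<rbrakk> \<Longrightarrow> \<exists>D\<in>\<F>. D \<subseteq> A \<inter> B"
  shows "\<exists>F\<in>\<F>. F \<subseteq> \<Inter>\<G>"
  using assms(1,2)
proof (induction rule: finite_induct)
  case (insert A \<G>)
  then obtain F where F: "F \<in> \<F>" "F \<subseteq> \<Inter>\<G>"
    by (meson insert_subset)
  moreover obtain D where "D \<in> \<F>" "D \<subseteq> A \<inter> F"
    using assms(4) [of A F] insert.prems F(1) by (meson insert_subset)
  ultimately have "D \<subseteq> \<Inter>(insert A \<G>)"
    by auto
  with \<open>D \<in> \<F>\<close> show ?case
    by (rule rev_bexI)
qed (use assms(3) in auto)

text \<open>In a downward directed family, the finite subfamily provided by compactness can be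
  replaced by a single member below all of its elements.\<close>

lemma compactin_directed_Inter_subset_open:
  assumes "compactin X C" "\<And>F. F \<in> \<F> \<Longrightarrow> closedin X F" "openin X W" "C \<inter> \<Inter>\<F> \<subseteq> W"
    and "\<F> \<noteq> {}" "\<And>A B. \<lbrakk>A \<in> \<F>; B \<in> \<F>\<rbrakk> \<Longrightarrow> \<exists>D\<in>\<F>. D \<subseteq> A \<inter> B"
  obtains F where "F \<in> \<F>" "C \<inter> F \<subseteq> W"
proof -
  obtain \<G> where \<G>: "finite \<G>" "\<G> \<subseteq> \<F>" "C \<inter> \<Inter>\<G> \<subseteq> W"
    using compactin_Inter_subset_open [OF assms(1-4)] .
  obtain F where "F \<in> \<F>" "F \<subseteq> \<Inter>\<G>"
    using finite_Inter_directed [OF \<G>(1,2) assms(5,6)] by auto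
  moreover have "C \<inter> F \<subseteq> W"
    using calculation \<G>(3) by auto
  ultimately show thesis
    by (intro that)
qed

section \<open>Open normal subgroups and topological automorphisms\<close>

lemma (in group) normal_Inter_carrier:
  assumes "\<And>N. N \<in> F \<Longrightarrow> N \<lhd> G"
  shows "carrier G \<inter> \<Inter>F \<lhd> G"
proof -
  have "subgroup (carrier G \<inter> \<Inter>F) G"
    using assms by (intro subgroup_Inter_carrier) (simp add: normal_imp_subgroup)
  then show ?thesis
    using assms by (auto simp: normal_inv_iff)
qed

text \<open>Unlike the elements of \<open>AutoGroup\<close>, these maps need not be extensional.
  Conjugation by an element of an ambient group thus counts as an automorphism of any subgroup that
  it preserves, without being restricted first.\<close>

definition topological_automorphisms :: "('a, 'b) monoid_scheme \<Rightarrow> 'a topology \<Rightarrow> ('a \<Rightarrow> 'a) set"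
  where "topological_automorphisms G T = {f \<in> hom G G. homeomorphic_map T T f}"

definition proper_open_normals :: "('a, 'b) monoid_scheme \<Rightarrow> 'a topology \<Rightarrow> 'a set set"
  where "proper_open_normals G T = {N. N \<lhd> G \<and> openin T N \<and> N \<noteq> carrier G}"

context topological_group
begin

lemma topological_automorphism_iso:
  assumes "f \<in> topological_automorphisms G T"
  shows "f \<in> iso G G"
  using assms homeomorphic_imp_surjective_map [of T T f] homeomorphic_imp_injective_map [of T T f]
  by (auto simp: topological_automorphisms_def iso_def bij_betw_def topspace_eq_carrier)

lemma topological_automorphism_inverse:
  assumes f: "f \<in> topological_automorphisms G T"
  obtains g where "g \<in> topological_automorphisms G T"
    "\<And>x. x \<in> carrier G \<Longrightarrow> f (g x) = x" "\<And>x. x \<in> carrier G \<Longrightarrow> g (f x) = x"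
proof -
  obtain g where g: "homeomorphic_maps T T f g"
    using f by (auto simp: topological_automorphisms_def homeomorphic_map_maps)
  then have inv: "f (g x) = x" "g (f x) = x" if "x \<in> carrier G" for x
    using that by (auto simp: homeomorphic_maps_def topspace_eq_carrier)
  have hg: "homeomorphic_map T T g"
    using g homeomorphic_maps_sym homeomorphic_maps_imp_map by blast
  then have cl: "g x \<in> carrier G" if "x \<in> carrier G" for x
    using that homeomorphic_imp_surjective_map [OF hg] topspace_eq_carrier by auto
  have "g (x \<otimes> y) = g x \<otimes> g y" if "x \<in> carrier G" "y \<in> carrier G" for x y
  proof -
    have "f (g x \<otimes> g y) = f (g x) \<otimes> f (g y)"
      using f that cl by (auto simp: topological_automorphisms_def intro: hom_mult)
    then have "f (g x \<otimes> g y) = x \<otimes> y"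
      using that inv by simp
    then show ?thesis
      using inv(2) [of "g x \<otimes> g y"] that cl by simp
  qed
  then have "g \<in> topological_automorphisms G T"
    using hg cl by (auto simp: topological_automorphisms_def intro: homI)
  then show thesis
    using inv by (rule that)
qed

text \<open>If \<open>g\<close> is the inverse of \<open>f\<close>, then a point of the intersection
  lies in the image of \<open>N\<close> under \<open>g\<close>, since this image is again in the
  family; applying \<open>f\<close> brings the point into \<open>N\<close>.\<close>

lemma topological_automorphism_image_Inter:
  assumes "\<And>f N. \<lbrakk>f \<in> topological_automorphisms G T; N \<in> \<M>\<rbrakk> \<Longrightarrow> f ` N \<in> \<M>"
    and "f \<in> topological_automorphisms G T"
    and "\<And>N. N \<in> \<M> \<Longrightarrow> N \<subseteq> carrier G"
  shows "f ` (carrier G \<inter> \<Inter>\<M>) \<subseteq> carrier G \<inter> \<Inter>\<M>"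
proof -
  obtain g where g: "g \<in> topological_automorphisms G T" "\<And>x. x \<in> carrier G \<Longrightarrow> f (g x) = x"
    using topological_automorphism_inverse [OF assms(2)] by metis
  have "f x \<in> carrier G" if "x \<in> carrier G" for x
    using that assms(2) by (auto simp: topological_automorphisms_def hom_in_carrier)
  moreover have "f x \<in> N" if x: "x \<in> \<Inter>\<M>" and N: "N \<in> \<M>" for x N
  proof -
    have "x \<in> g ` N"
      using x assms(1) [OF g(1) N] by auto
    then show ?thesis
      using g(2) assms(3) [OF N] by auto
  qed
  ultimately show ?thesis
    by auto
qed

lemma topological_automorphism_normal_image:
  assumes "f \<in> topological_automorphisms G T" "N \<lhd> G"
  shows "f ` N \<lhd> G"
  using assms by (intro iso_normal_subgroup [OF topological_automorphism_iso]) (auto simp: group_axioms)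

lemma topological_automorphism_open_image:
  assumes "f \<in> topological_automorphisms G T" "openin T N"
  shows "openin T (f ` N)"
  using assms homeomorphic_imp_open_map [of T T f]
  by (auto simp: topological_automorphisms_def open_map_def)

lemma topological_automorphism_proper_open_normals:
  assumes "f \<in> topological_automorphisms G T" "N \<in> proper_open_normals G T"
  shows "f ` N \<in> proper_open_normals G T"
proof -
  obtain g where g: "g \<in> topological_automorphisms G T" "\<And>x. x \<in> carrier G \<Longrightarrow> g (f x) = x"
    using topological_automorphism_inverse [OF assms(1)] by metis
  have N: "N \<subseteq> carrier G" "N \<noteq> carrier G"
    using assms(2) openin_subset_carrier by (auto simp: proper_open_normals_def)
  have "f ` N \<noteq> carrier G"
  proof
    assume eq: "f ` N = carrier G"
    have "carrier G \<subseteq> N"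
    proof
      fix x assume x: "x \<in> carrier G"
      then have "f x \<in> carrier G"
        using assms(1) by (auto simp: topological_automorphisms_def hom_in_carrier)
      then obtain n where "n \<in> N" "f x = f n"
        using eq by blast
      then show "x \<in> N"
        using g(2) [OF x] g(2) [of n] N by auto
    qed
    then show False
      using N by auto
  qed
  then show ?thesis
    using assms by (simp add: proper_open_normals_def topological_automorphism_normal_image
        topological_automorphism_open_image)
qed

text \<open>Zorn's lemma. The union of a chain stays proper by compactness: if it were all of
  \<open>G\<close>, finitely many members would cover \<open>G\<close>, and the largest of these
  would equal \<open>G\<close>.\<close>

lemma ex_maximal_proper_open_normal:
  assumes "compact_space T" "proper_open_normals G T \<noteq> {}"
  shows "\<exists>N\<in>proper_open_normals G T. \<forall>N'\<in>proper_open_normals G T. N \<subseteq> N' \<longrightarrow> N' = N"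
proof (rule subset_Zorn_nonempty [OF assms(2)])
  fix \<C> assume ne: "\<C> \<noteq> {}" and chain: "subset.chain (proper_open_normals G T) \<C>"
  then have \<C>: "N \<lhd> G" "openin T N" "N \<noteq> carrier G" if "N \<in> \<C>" for N
    using that by (auto simp: subset.chain_def proper_open_normals_def)
  have lin: "A \<subseteq> B \<or> B \<subseteq> A" if "A \<in> \<C>" "B \<in> \<C>" for A B
    using chain that by (auto simp: subset_chain_def)
  have sub: "subgroup (\<Union>\<C>) G"
  proof (rule subgroupI)
    show "\<Union>\<C> \<subseteq> carrier G"
      using \<C>(2) openin_subset_carrier by blast
    show "\<Union>\<C> \<noteq> {}"
      using ne subgroup.one_closed [OF normal_imp_subgroup [OF \<C>(1)]] by auto
    show "inv a \<in> \<Union>\<C>" if "a \<in> \<Union>\<C>" for a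
      using that subgroup.m_inv_closed [OF normal_imp_subgroup [OF \<C>(1)]] by auto
    show "a \<otimes> b \<in> \<Union>\<C>" if ab: "a \<in> \<Union>\<C>" "b \<in> \<Union>\<C>" for a b
    proof -
      obtain A B where "A \<in> \<C>" "B \<in> \<C>" "a \<in> A" "b \<in> B"
        using ab by auto
      then obtain D where "D \<in> \<C>" "a \<in> D" "b \<in> D"
        using lin [of A B] by blast
      then show ?thesis
        using subgroup.m_closed [OF normal_imp_subgroup [OF \<C>(1)]] by auto
    qed
  qed
  have "\<Union>\<C> \<noteq> carrier G"
  proof
    assume "\<Union>\<C> = carrier G"
    then obtain \<B> where \<B>: "finite \<B>" "\<B> \<subseteq> \<C>" "carrier G \<subseteq> \<Union>\<B>"
      using compactinD [OF assms(1) [unfolded compact_space_def], of \<C>] \<C>(2) topspace_eq_carrier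
      by auto
    have "\<B> \<noteq> {}"
      using \<B>(3) one_closed by auto
    moreover have "subset.chain \<C> \<B>"
      unfolding subset_chain_def using \<B>(2) lin by blast
    ultimately have "\<Union>\<B> \<in> \<C>"
      using Union_in_chain \<B>(1,2) by blast
    then show False
      using \<C>(2,3) \<B>(3) openin_subset_carrier by blast
  qed
  moreover have "\<Union>\<C> \<lhd> G"
    using sub \<C>(1) by (auto simp: normal_inv_iff)
  ultimately show "\<Union>\<C> \<in> proper_open_normals G T"
    using \<C>(2) by (auto simp: proper_open_normals_def)
qed

text \<open>A disconnection yields a proper clopen set. Its stabilizer under left translation is an
  open subgroup, and the normal core of that stabilizer is still open because \<open>G\<close> is
  compact.\<close>

lemma compact_ex_proper_open_normal:
  assumes "compact_space T" "totally_disconnected_space T" "carrier G \<noteq> {\<one>}"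
  shows "proper_open_normals G T \<noteq> {}"
proof -
  have "\<not> connected_space T"
  proof
    assume "connected_space T"
    then obtain a where "carrier G \<subseteq> {a}"
      using assms(2) topspace_eq_carrier
      by (metis connectedin_topspace totally_disconnected_space_def)
    then show False
      using assms(3) one_closed by blast
  qed
  then obtain C0 where C0: "openin T C0" "closedin T C0" "C0 \<noteq> {}" "C0 \<noteq> carrier G"
    using connected_space_clopen_in topspace_eq_carrier by metis
  then obtain c where c: "c \<in> C0" "c \<in> carrier G"
    using openin_subset_carrier by blast
  \<comment> \<open>The clopen set is translated so that it contains the identity; this forces its
    stabilizer \<open>S\<close> to lie inside it and hence to be proper.\<close>
  define C where "C = inv c <# C0"
  have C: "openin T C" "closedin T C"
    using C0 c by (simp_all add: C_def openin_l_coset closedin_l_coset)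
  have C_iff: "x \<in> C \<longleftrightarrow> c \<otimes> x \<in> C0" if "x \<in> carrier G" for x
  proof
    assume "x \<in> C"
    then obtain y where "y \<in> C0" "x = inv c \<otimes> y"
      by (auto simp: C_def l_coset_def)
    then show "c \<otimes> x \<in> C0"
      using c C0(1) openin_subset_carrier by (auto simp: m_assoc [symmetric] subset_iff)
  next
    assume "c \<otimes> x \<in> C0"
    moreover have "x = inv c \<otimes> (c \<otimes> x)"
      using c that by (simp add: m_assoc [symmetric])
    ultimately show "x \<in> C"
      unfolding C_def l_coset_def by blast
  qed
  have "\<one> \<in> C"
    using C_iff c by simp
  have "C \<noteq> carrier G"
  proof
    assume "C = carrier G"
    then have "c \<otimes> (inv c \<otimes> x) \<in> C0" if "x \<in> carrier G" for x
      using that c C_iff by simp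
    then have "carrier G \<subseteq> C0"
      using c by (auto simp: m_assoc [symmetric])
    then show False
      using C0 openin_subset_carrier by blast
  qed
  define S where "S = {x \<in> carrier G. \<forall>y\<in>carrier G. x \<otimes> y \<in> C \<longleftrightarrow> y \<in> C}"
  have S: "subgroup S G"
  proof (rule subgroupI)
    show "S \<noteq> {}"
      using one_closed by (force simp: S_def)
    show "inv a \<in> S" if "a \<in> S" for a
    proof -
      have "a \<otimes> (inv a \<otimes> y) \<in> C \<longleftrightarrow> inv a \<otimes> y \<in> C" if "y \<in> carrier G" for y
        using \<open>a \<in> S\<close> that by (simp add: S_def)
      then show ?thesis
        using that by (simp add: S_def m_assoc [symmetric])
    qed
    show "a \<otimes> b \<in> S" if "a \<in> S" "b \<in> S" for a b
      using that by (simp add: S_def m_assoc)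
  qed (auto simp: S_def)
  have "S \<subseteq> C"
  proof
    fix x assume x: "x \<in> S"
    then have "x \<otimes> \<one> \<in> C"
      using \<open>\<one> \<in> C\<close> one_closed unfolding S_def by blast
    then show "x \<in> C"
      using x by (simp add: S_def)
  qed
  have "openin T S"
  proof -
    \<comment> \<open>\<open>B\<close> consists of the pairs that violate the condition defining
      \<open>S\<close>. It is closed since \<open>C\<close> is clopen, and projection along the
      compact second factor is a closed map, so the complement \<open>S\<close> of its projection is
      open.\<close>
    define B where "B = {p \<in> carrier G \<times> carrier G. (fst p \<otimes> snd p \<in> C) \<noteq> (snd p \<in> C)}"
    have pre: "closedin (prod_topology T T) {p \<in> topspace (prod_topology T T). (\<lambda>(x, y). x \<otimes> y) p \<in> D}"
      "closedin (prod_topology T T) {p \<in> topspace (prod_topology T T). snd p \<in> D}"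
      if "closedin T D" for D
      using that closedin_continuous_map_preimage [OF continuous_mult]
        closedin_continuous_map_preimage [OF continuous_map_snd] by blast+
    have D: "closedin T (carrier G - C)"
      using C(1) topspace_eq_carrier by (metis closedin_diff closedin_topspace openin_closedin_eq double_diff
        openin_subset_carrier openin_closedin)
    have "B = ({p \<in> topspace (prod_topology T T). (\<lambda>(x, y). x \<otimes> y) p \<in> C} \<inter>
            {p \<in> topspace (prod_topology T T). snd p \<in> carrier G - C})
        \<union> ({p \<in> topspace (prod_topology T T). (\<lambda>(x, y). x \<otimes> y) p \<in> carrier G - C} \<inter>
            {p \<in> topspace (prod_topology T T). snd p \<in> C})"
      by (auto simp: B_def topspace_eq_carrier)
    then have "closedin (prod_topology T T) B"
      using pre [OF D] pre [OF C(2)] by (simp only: closedin_Un closedin_Int)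
    then have "closedin T (fst ` B)"
      using closed_map_fst [OF assms(1), of T] unfolding closed_map_def by blast
    moreover have "S = topspace T - fst ` B"
      by (force simp: S_def B_def topspace_eq_carrier)
    ultimately show ?thesis
      by (simp add: openin_diff)
  qed
  \<comment> \<open>The normal core of \<open>S\<close>; only finitely many distinct conjugates
    occur because \<open>G\<close> is compact and \<open>S\<close> is open.\<close>
  define N where "N = (\<Inter>g\<in>carrier G. inner_aut G g ` S)"
  have "open_subgroup G T S"
    using S \<open>openin T S\<close> by (simp add: open_subgroup_def)
  then have "open_subgroup G T N"
    unfolding N_def using finite_inner_aut_images [of "carrier G" S] assms(1) topspace_eq_carrier
    by (intro open_subgroup_finite_Inter) (auto simp: compact_space_def open_subgroup_inner_aut_image)
  have "inner_aut G x h \<in> N" if x: "x \<in> carrier G" and h: "h \<in> N" for x h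
  proof -
    have "h \<in> carrier G"
      using h \<open>open_subgroup G T N\<close> openin_subset_carrier by (auto simp: open_subgroup_def)
    have "inner_aut G x h \<in> inner_aut G g ` S" if g: "g \<in> carrier G" for g
    proof -
      \<comment> \<open>Conjugation by \<open>x\<close> permutes the conjugates of \<open>S\<close>:
        the one indexed by \<open>inv x \<otimes> g\<close> is carried to the one indexed by
        \<open>g\<close>.\<close>
      have "h \<in> inner_aut G (inv x \<otimes> g) ` S"
        using h x g by (auto simp: N_def)
      then have "inner_aut G x h \<in> inner_aut G x ` inner_aut G (inv x \<otimes> g) ` S"
        by (rule imageI)
      also have "\<dots> = inner_aut G (x \<otimes> (inv x \<otimes> g)) ` S"
        using x g subgroup.subset [OF S] by (subst inner_aut_image_mult [of x]) auto
      also have "x \<otimes> (inv x \<otimes> g) = g"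
        using x g by (simp add: m_assoc [symmetric])
      finally show ?thesis .
    qed
    then show ?thesis
      by (simp add: N_def)
  qed
  then have "N \<lhd> G"
    using \<open>open_subgroup G T N\<close> openin_subset_carrier
    by (auto simp: normal_inv_iff open_subgroup_def inner_aut_apply subset_iff)
  moreover have "N \<subseteq> S"
    using inner_aut_image_one [OF subgroup.subset [OF S]] by (auto simp: N_def)
  ultimately have "N \<in> proper_open_normals G T"
    using \<open>S \<subseteq> C\<close> \<open>C \<noteq> carrier G\<close> \<open>open_subgroup G T N\<close> openin_subset_carrier [OF C(1)]
    by (auto simp: proper_open_normals_def open_subgroup_def)
  then show ?thesis
    by auto
qed

end

section \<open>Characteristic subgroups of infinite compact just infinite groups\<close>

locale compact_just_infinite_group = topological_group +
  assumes compact: "compact_space T"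
    and totally_disconnected: "totally_disconnected_space T"
    and nondiscrete: "\<not> openin T {\<one>}"
    and openin_normal: "\<lbrakk>N \<lhd> G; closedin T N; N \<noteq> {\<one>}\<rbrakk> \<Longrightarrow> openin T N"
begin

text \<open>Finite sets are closed in a Hausdorff space, so removing the other elements from a
  finite open subgroup would make the identity an open point.\<close>

lemma infinite_open_subgroup:
  assumes "subgroup N G" "openin T N"
  shows "infinite N"
proof
  assume "finite N"
  then have "closedin T (N - {\<one>})"
    using assms(2) Hausdorff openin_subset by (intro closedin_Hausdorff_finite) auto
  then have "openin T (N - (N - {\<one>}))"
    using assms(2) by (rule openin_diff [rotated])
  moreover have "N - (N - {\<one>}) = {\<one>}"
    using subgroup.one_closed [OF assms(1)] by auto
  ultimately show False
    using nondiscrete by simp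
qed

lemma closedin_proper_open_normal: "N \<in> proper_open_normals G T \<Longrightarrow> closedin T N"
  by (intro closedin_open_subgroup) (auto simp: proper_open_normals_def open_subgroup_def normal_imp_subgroup)

lemma closedin_Inter_carrier:
  assumes "\<And>N. N \<in> \<M> \<Longrightarrow> closedin T N"
  shows "closedin T (carrier G \<inter> \<Inter>\<M>)"
proof -
  have "closedin T (carrier G)"
    using closedin_topspace topspace_eq_carrier by metis
  then have "closedin T (\<Inter>(insert (carrier G) \<M>))"
    using assms by (intro closedin_Inter) auto
  then show ?thesis
    by simp
qed

text \<open>With \<open>n\<close> the order of the quotient by \<open>N\<close>, the
  \<open>n\<close>-th powers form a closed subgroup contained in \<open>N\<close> and preserved by
  every endomorphism. If they were trivial, the group would have finite exponent, which just
  infiniteness excludes.\<close>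

lemma ex_characteristic_if_abelian:
  assumes comm: "\<And>x y. \<lbrakk>x \<in> carrier G; y \<in> carrier G\<rbrakk> \<Longrightarrow> x \<otimes> y = y \<otimes> x"
    and N: "N \<in> proper_open_normals G T"
  shows "\<exists>M\<in>proper_open_normals G T. \<forall>f\<in>topological_automorphisms G T. f ` M \<subseteq> M"
proof -
  have Nn: "N \<lhd> G" "openin T N" "N \<noteq> carrier G"
    using N by (auto simp: proper_open_normals_def)
  interpret N: normal N G by fact
  interpret Q: group "G Mod N" by (rule N.factorgroup_is_group)
  define n where "n = order (G Mod N)"
  have "finite (carrier (G Mod N))"
    using compact_finite_rcosets [OF compact] Nn N.subgroup_axioms by (simp add: FactGroup_def open_subgroup_def)
  then have "n > 0"
    by (simp add: n_def Q.order_gt_0_iff_finite)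
  have pow_N: "x [^] n \<in> N" if x: "x \<in> carrier G" for x
  proof -
    have "N #> x \<in> carrier (G Mod N)"
      using x by (auto simp: FactGroup_def RCOSETS_def)
    then have "(N #> x) [^]\<^bsub>G Mod N\<^esub> n = \<one>\<^bsub>G Mod N\<^esub>"
      unfolding n_def by (rule Q.pow_order_eq_1)
    then have "N #> (x [^] n) = N"
      using x by (simp add: N.FactGroup_pow)
    then show ?thesis
      using coset_join1 N.subgroup_axioms x by simp
  qed
  have normal: "P \<lhd> G" if "subgroup P G" for P
    using that comm_group.subgroup_imp_normal [OF group_comm_groupI [OF comm]] by simp
  define P where "P = (\<lambda>x. x [^] n) ` carrier G"
  have "(\<lambda>x. x [^] n) \<in> hom G G"
    using comm by (intro homI) (auto simp: pow_mult_distrib)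
  then interpret pow: group_hom G G "\<lambda>x. x [^] n"
    by unfold_locales
  have "P \<lhd> G"
    unfolding P_def by (intro normal pow.img_is_subgroup)
  have "continuous_map T T (\<lambda>x. x [^] m)" for m :: nat
  proof (induction m)
    case (Suc m)
    then show ?case
      using continuous_map_times [OF Suc continuous_map_id [unfolded id_def]] by simp
  qed (simp add: topspace_eq_carrier)
  then have "compactin T P"
    unfolding P_def using compact topspace_eq_carrier
    by (intro image_compactin [of T]) (auto simp: compact_space_def)
  then have "closedin T P"
    by (rule compactin_imp_closedin [OF Hausdorff])
  show ?thesis
  proof (cases "P = {\<one>}")
    case False
    then have "openin T P"
      by (intro openin_normal \<open>P \<lhd> G\<close> \<open>closedin T P\<close>)
    moreover have "P \<subseteq> N"
      using pow_N by (auto simp: P_def)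
    then have "P \<noteq> carrier G"
      using Nn(3) N.subset by auto
    ultimately have "P \<in> proper_open_normals G T"
      using \<open>P \<lhd> G\<close> by (simp add: proper_open_normals_def)
    moreover have "f ` P \<subseteq> P" if f: "f \<in> topological_automorphisms G T" for f
    proof -
      have "f \<in> hom G G"
        using f by (simp add: topological_automorphisms_def)
      then interpret f: group_hom G G f
        by unfold_locales
      show ?thesis
        by (auto simp: P_def f.hom_nat_pow)
    qed
    ultimately show ?thesis
      by blast
  next
    case True
    have "carrier G \<noteq> {\<one>}"
      using nondiscrete openin_topspace topspace_eq_carrier by metis
    then obtain x where x: "x \<in> carrier G" "x \<noteq> \<one>"
      using one_closed by blast
    \<comment> \<open>A nontrivial element of finite order generates a finite subgroup, normal by
      commutativity and closed as a finite set. Just infiniteness would make it open, although open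
      subgroups are infinite.\<close>
    define Q where "Q = carrier (subgroup_generated G {x})"
    have "x [^] n = \<one>"
      using True x by (auto simp: P_def)
    then have "finite Q"
      using \<open>n > 0\<close> x unfolding Q_def finite_cyclic_subgroup [OF x(1)] by auto
    have sub: "subgroup Q G"
      unfolding Q_def by (rule subgroup_subgroup_generated)
    have "x [^] (1::int) \<in> Q"
      using x carrier_subgroup_generated_by_singleton [OF x(1)] unfolding Q_def by blast
    then have "Q \<noteq> {\<one>}"
      using x by auto
    moreover have "closedin T Q"
      using \<open>finite Q\<close> subgroup.subset [OF sub] topspace_eq_carrier Hausdorff
      by (intro closedin_Hausdorff_finite) auto
    ultimately have "openin T Q"
      by (intro openin_normal normal sub)
    then show ?thesis
      using infinite_open_subgroup sub \<open>finite Q\<close> by blast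
  qed
qed

text \<open>Automorphisms permute the proper open normal subgroups with abelian quotient, so the
  intersection \<open>D\<close> of these is invariant. Either \<open>D\<close> is open, or it is
  trivial; in the latter case all commutators vanish and the abelian case applies.\<close>

lemma ex_characteristic_if_abelian_quotient:
  assumes N: "N \<in> proper_open_normals G T"
    and comm: "\<And>x y. \<lbrakk>x \<in> carrier G; y \<in> carrier G\<rbrakk> \<Longrightarrow> x \<otimes> y \<otimes> inv (y \<otimes> x) \<in> N"
  shows "\<exists>M\<in>proper_open_normals G T. \<forall>f\<in>topological_automorphisms G T. f ` M \<subseteq> M"
proof -
  define \<A> where "\<A> = {A. A \<in> proper_open_normals G T \<and>
    (\<forall>x\<in>carrier G. \<forall>y\<in>carrier G. x \<otimes> y \<otimes> inv (y \<otimes> x) \<in> A)}"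
  have \<A>: "A \<lhd> G" "closedin T A" "A \<subseteq> carrier G" if "A \<in> \<A>" for A
    using that closedin_proper_open_normal openin_subset_carrier
    by (auto simp: \<A>_def proper_open_normals_def)
  have \<A>_image: "f ` A \<in> \<A>" if f: "f \<in> topological_automorphisms G T" and A: "A \<in> \<A>" for f A
  proof -
    obtain g where g: "g \<in> topological_automorphisms G T" "\<And>x. x \<in> carrier G \<Longrightarrow> f (g x) = x"
      using topological_automorphism_inverse [OF f] by metis
    have hom: "g \<in> hom G G" "f \<in> hom G G"
      using f g(1) by (auto simp: topological_automorphisms_def)
    interpret f: group_hom G G f by unfold_locales (rule hom(2))
    have "x \<otimes> y \<otimes> inv (y \<otimes> x) \<in> f ` A" if xy: "x \<in> carrier G" "y \<in> carrier G" for x y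
    proof -
      have gc: "g x \<in> carrier G" "g y \<in> carrier G"
        using hom(1) xy by (auto simp: hom_in_carrier)
      then have "g x \<otimes> g y \<otimes> inv (g y \<otimes> g x) \<in> A"
        using A by (simp add: \<A>_def)
      then have "f (g x \<otimes> g y \<otimes> inv (g y \<otimes> g x)) \<in> f ` A"
        by (rule imageI)
      then show ?thesis
        using gc xy g(2) by simp
    qed
    then show ?thesis
      using A topological_automorphism_proper_open_normals [OF f] by (auto simp: \<A>_def)
  qed
  define D where "D = carrier G \<inter> \<Inter>\<A>"
  have D: "D \<lhd> G" "closedin T D"
    unfolding D_def using \<A>(1,2) by (auto intro!: normal_Inter_carrier closedin_Inter_carrier)
  have inv: "f ` D \<subseteq> D" if "f \<in> topological_automorphisms G T" for f
    unfolding D_def using \<A>_image that \<A>(3) by (rule topological_automorphism_image_Inter)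
  have "D \<subseteq> N"
    using N comm by (auto simp: D_def \<A>_def)
  show ?thesis
  proof (cases "D = {\<one>}")
    case False
    then have "openin T D"
      by (intro openin_normal D)
    moreover have "D \<noteq> carrier G"
      using \<open>D \<subseteq> N\<close> N openin_subset_carrier by (auto simp: proper_open_normals_def)
    ultimately have "D \<in> proper_open_normals G T"
      using D(1) by (simp add: proper_open_normals_def)
    then show ?thesis
      using inv by blast
  next
    case True
    have "x \<otimes> y = y \<otimes> x" if xy: "x \<in> carrier G" "y \<in> carrier G" for x y
    proof -
      have "x \<otimes> y \<otimes> inv (y \<otimes> x) \<in> D"
        using xy by (auto simp: D_def \<A>_def)
      then have "x \<otimes> y \<otimes> inv (y \<otimes> x) = \<one>"
        using True by simp
      then show ?thesis
        using xy by (metis inv_equality inv_inv m_closed inv_closed)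
    qed
    then show ?thesis
      using N by (rule ex_characteristic_if_abelian)
  qed
qed

text \<open>A maximal open normal subgroup with non-abelian quotient is prime with respect to
  intersections, since \<open>[A, B] \<subseteq> A \<inter> B\<close>.\<close>

lemma maximal_proper_open_normal_prime:
  assumes N: "N \<in> proper_open_normals G T"
    and max: "\<And>N'. \<lbrakk>N' \<in> proper_open_normals G T; N \<subseteq> N'\<rbrakk> \<Longrightarrow> N' = N"
    and noncomm: "x \<in> carrier G" "y \<in> carrier G" "x \<otimes> y \<otimes> inv (y \<otimes> x) \<notin> N"
    and AB: "A \<lhd> G" "B \<lhd> G" "A \<inter> B \<subseteq> N"
  shows "A \<subseteq> N \<or> B \<subseteq> N"
proof (rule ccontr)
  assume neg: "\<not> (A \<subseteq> N \<or> B \<subseteq> N)"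
  have Nn: "N \<lhd> G" "openin T N"
    using N by (auto simp: proper_open_normals_def)
  interpret N: normal N G by fact
  \<comment> \<open>For a normal subgroup \<open>C\<close> not contained in \<open>N\<close>,
    maximality of \<open>N\<close> forces the product of \<open>N\<close> and \<open>C\<close> to be
    \<open>G\<close>. Hence every element is congruent modulo \<open>N\<close> to an element of
    \<open>C\<close>.\<close>
  have decomp: "\<exists>c\<in>C. N #> z = N #> c" if C: "C \<lhd> G" "\<not> C \<subseteq> N" and z: "z \<in> carrier G" for C z
  proof -
    have Cc: "C \<subseteq> carrier G"
      using C(1) normal_imp_subgroup subgroup.subset by blast
    have "N <#> C \<lhd> G"
      using Nn(1) C(1) by (rule normal_subgroup_set_mult_closed)
    moreover have "openin T (N <#> C)"
      using Cc Nn(2) by (rule openin_set_mult(2))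
    moreover have "N \<subseteq> N <#> C"
    proof
      fix a assume "a \<in> N"
      then have "a = a \<otimes> \<one>"
        by simp
      then show "a \<in> N <#> C"
        using \<open>a \<in> N\<close> subgroup.one_closed [OF normal_imp_subgroup [OF C(1)]]
        unfolding set_mult_def by blast
    qed
    moreover have "C \<subseteq> N <#> C"
    proof
      fix c assume "c \<in> C"
      then have "c = \<one> \<otimes> c"
        using Cc by auto
      then show "c \<in> N <#> C"
        using \<open>c \<in> C\<close> N.one_closed unfolding set_mult_def by blast
    qed
    ultimately have "N <#> C = carrier G"
      using max [of "N <#> C"] C(2) by (auto simp: proper_open_normals_def)
    then obtain a c where ac: "a \<in> N" "c \<in> C" "z = a \<otimes> c"
      using z unfolding set_mult_def by blast
    have "N #> z = (N #> a) #> c"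
      using ac Cc by (simp add: coset_mult_assoc N.subset subset_iff)
    then have "N #> z = N #> c"
      using ac N.subgroup_axioms by (simp add: coset_join2)
    then show ?thesis
      using ac by blast
  qed
  obtain a where a: "a \<in> A" "N #> x = N #> a"
    using decomp [OF AB(1) _ noncomm(1)] neg by blast
  obtain b where b: "b \<in> B" "N #> y = N #> b"
    using decomp [OF AB(2) _ noncomm(2)] neg by blast
  interpret A: normal A G by fact
  interpret B: normal B G by fact
  have ab: "a \<in> carrier G" "b \<in> carrier G"
    using a b by auto
  \<comment> \<open>The two bracketings of the commutator of \<open>a\<close> and \<open>b\<close>
    show that it lies in \<open>A\<close> and in \<open>B\<close>.\<close>
  have "a \<otimes> (b \<otimes> inv a \<otimes> inv b) \<in> A"
    using subgroup.m_closed [OF A.subgroup_axioms a(1) A.inv_op_closed2 [OF ab(2)]] a(1) by simp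
  moreover have "(a \<otimes> b \<otimes> inv a) \<otimes> inv b \<in> B"
    using subgroup.m_closed [OF B.subgroup_axioms B.inv_op_closed2 [OF ab(1) b(1)]] b(1) by simp
  ultimately have c: "a \<otimes> b \<otimes> inv (b \<otimes> a) \<in> N"
    using subsetD [OF AB(3), of "a \<otimes> b \<otimes> inv (b \<otimes> a)"] ab by (simp add: m_assoc inv_mult_group)
  \<comment> \<open>Modulo \<open>N\<close>, the elements \<open>x\<close> and \<open>y\<close>
    coincide with \<open>a\<close> and \<open>b\<close>, which commute there; this contradicts the
    choice of \<open>x\<close> and \<open>y\<close>.\<close>
  have "N #> (x \<otimes> y) = N #> (a \<otimes> b)"
    using N.rcos_sum [OF noncomm(1,2)] N.rcos_sum [OF ab] a b by simp
  also have "a \<otimes> b = (a \<otimes> b \<otimes> inv (b \<otimes> a)) \<otimes> (b \<otimes> a)"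
    using ab by (simp add: m_assoc)
  also have "N #> \<dots> = (N #> (a \<otimes> b \<otimes> inv (b \<otimes> a))) #> (b \<otimes> a)"
    using ab by (intro coset_mult_assoc [symmetric] N.subset) auto
  also have "\<dots> = N #> (b \<otimes> a)"
    using c ab N.subgroup_axioms by (simp add: coset_join2)
  also have "\<dots> = N #> (y \<otimes> x)"
    using N.rcos_sum [OF noncomm(2,1)] N.rcos_sum [OF ab(2,1)] a b by simp
  finally have "x \<otimes> y \<in> N #> (y \<otimes> x)"
    using rcos_self [OF m_closed [OF noncomm(1,2)] N.subgroup_axioms] by simp
  then obtain h where "h \<in> N" "x \<otimes> y = h \<otimes> (y \<otimes> x)"
    by (auto simp: r_coset_def)
  then have "x \<otimes> y \<otimes> inv (y \<otimes> x) = h"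
    using noncomm by (simp add: m_assoc)
  then show False
    using \<open>h \<in> N\<close> noncomm(3) by simp
qed

text \<open>Induction from the case of two subgroups. For the empty family the hypothesis would put
  all of \<open>G\<close> inside the proper subgroup \<open>N\<close>.\<close>

lemma maximal_proper_open_normal_prime_finite:
  assumes N: "N \<in> proper_open_normals G T"
    and max: "\<And>N'. \<lbrakk>N' \<in> proper_open_normals G T; N \<subseteq> N'\<rbrakk> \<Longrightarrow> N' = N"
    and noncomm: "x \<in> carrier G" "y \<in> carrier G" "x \<otimes> y \<otimes> inv (y \<otimes> x) \<notin> N"
    and "finite \<G>" "\<And>A. A \<in> \<G> \<Longrightarrow> A \<lhd> G" "carrier G \<inter> \<Inter>\<G> \<subseteq> N"
  shows "\<exists>A\<in>\<G>. A \<subseteq> N"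
  using assms(6-8)
proof (induction rule: finite_induct)
  case empty
  then show ?case
    using N openin_subset_carrier by (auto simp: proper_open_normals_def)
next
  case (insert A \<G>)
  have "carrier G \<inter> \<Inter>\<G> \<lhd> G"
    using insert.prems(1) by (intro normal_Inter_carrier) auto
  moreover have "A \<inter> (carrier G \<inter> \<Inter>\<G>) \<subseteq> N"
    using insert.prems(2) by auto
  ultimately have "A \<subseteq> N \<or> carrier G \<inter> \<Inter>\<G> \<subseteq> N"
    using insert.prems(1) [of A] maximal_proper_open_normal_prime [OF N max noncomm] by blast
  then show ?case
    using insert.IH insert.prems(1) by auto
qed

text \<open>The intersection \<open>M\<close> of all maximal proper open normal subgroups is
  invariant, so only the case of trivial \<open>M\<close> needs work. There, a maximal
  \<open>N\<close> with abelian quotient leads to the preceding lemmas, while a nonabelian quotient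
  contradicts primality of \<open>N\<close>.\<close>

theorem ex_characteristic_proper_open:
  "\<exists>M\<in>proper_open_normals G T. \<forall>f\<in>topological_automorphisms G T. f ` M \<subseteq> M"
proof -
  define \<M> where "\<M> = {N \<in> proper_open_normals G T.
    \<forall>N'\<in>proper_open_normals G T. N \<subseteq> N' \<longrightarrow> N' = N}"
  have \<M>: "N \<in> proper_open_normals G T" "N \<lhd> G" "openin T N" "closedin T N" "N \<subseteq> carrier G"
    if "N \<in> \<M>" for N
    using that closedin_proper_open_normal openin_subset_carrier
    by (auto simp: \<M>_def proper_open_normals_def)
  have "carrier G \<noteq> {\<one>}"
    using nondiscrete openin_topspace topspace_eq_carrier by metis
  then obtain N where N: "N \<in> \<M>"
    using ex_maximal_proper_open_normal [OF compact] compact_ex_proper_open_normal [OF compact totally_disconnected]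
    by (auto simp: \<M>_def)
  \<comment> \<open>Maximality is transported by \<open>f\<close>: a subgroup containing the image
    of \<open>A\<close> is pulled back by \<open>g\<close> to one containing
    \<open>A\<close>.\<close>
  have \<M>_image: "f ` A \<in> \<M>" if f: "f \<in> topological_automorphisms G T" and A: "A \<in> \<M>" for f A
  proof -
    obtain g where g: "g \<in> topological_automorphisms G T"
        "\<And>x. x \<in> carrier G \<Longrightarrow> f (g x) = x" "\<And>x. x \<in> carrier G \<Longrightarrow> g (f x) = x"
      using topological_automorphism_inverse [OF f] by metis
    have "N' = f ` A" if N': "N' \<in> proper_open_normals G T" "f ` A \<subseteq> N'" for N'
    proof -
      have "N' \<subseteq> carrier G"
        using N'(1) openin_subset_carrier by (auto simp: proper_open_normals_def)
      then have fg: "f ` g ` N' = N'"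
        using g(2) by (force simp: image_image)
      have "A \<subseteq> g ` N'"
      proof
        fix a assume "a \<in> A"
        then have "g (f a) = a" "f a \<in> N'"
          using g(3) \<M>(5) [OF A] N'(2) by auto
        then show "a \<in> g ` N'"
          by (metis imageI)
      qed
      moreover have "g ` N' \<in> proper_open_normals G T"
        using g(1) N'(1) by (rule topological_automorphism_proper_open_normals)
      ultimately have "g ` N' = A"
        using A by (auto simp: \<M>_def)
      then show ?thesis
        using fg by simp
    qed
    then show ?thesis
      using topological_automorphism_proper_open_normals [OF f \<M>(1) [OF A]] by (auto simp: \<M>_def)
  qed
  define M where "M = carrier G \<inter> \<Inter>\<M>"
  have M: "M \<lhd> G" "closedin T M"
    unfolding M_def using \<M>(2,4) by (auto intro!: normal_Inter_carrier closedin_Inter_carrier)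
  show ?thesis
  proof (cases "M = {\<one>}")
    case False
    then have "openin T M"
      by (intro openin_normal M)
    moreover have "M \<subseteq> N"
      using N by (auto simp: M_def)
    then have "M \<noteq> carrier G"
      using \<M>(1,5) [OF N] by (auto simp: proper_open_normals_def)
    ultimately have "M \<in> proper_open_normals G T"
      using M(1) by (simp add: proper_open_normals_def)
    moreover have "f ` M \<subseteq> M" if "f \<in> topological_automorphisms G T" for f
      unfolding M_def using \<M>_image that \<M>(5) by (rule topological_automorphism_image_Inter)
    ultimately show ?thesis
      by blast
  next
    case True
    show ?thesis
    proof (cases "\<forall>x\<in>carrier G. \<forall>y\<in>carrier G. x \<otimes> y \<otimes> inv (y \<otimes> x) \<in> N")
      case True
      then show ?thesis
        by (intro ex_characteristic_if_abelian_quotient [OF \<M>(1) [OF N]]) auto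
    next
      case False
      then obtain x y where xy: "x \<in> carrier G" "y \<in> carrier G" "x \<otimes> y \<otimes> inv (y \<otimes> x) \<notin> N"
        by auto
      have max: "N' = N" if "N' \<in> proper_open_normals G T" "N \<subseteq> N'" for N'
        using that N by (auto simp: \<M>_def)
      \<comment> \<open>The other maximal subgroups intersect in \<open>C\<close>, which meets the
        open subgroup \<open>N\<close> trivially. So \<open>C\<close> is not open, hence trivial,
        and by compactness finitely many of them already intersect inside \<open>N\<close>.
        Primality puts one of these in \<open>N\<close>, against its maximality.\<close>
      define C where "C = carrier G \<inter> \<Inter>(\<M> - {N})"
      have C: "C \<lhd> G" "closedin T C"
        unfolding C_def using \<M>(2,4) by (auto intro!: normal_Inter_carrier closedin_Inter_carrier)
      have "C \<inter> N = {\<one>}"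
        using \<open>M = {\<one>}\<close> N by (auto simp: C_def M_def)
      then have "\<not> openin T C"
        using nondiscrete openin_Int [OF _ \<M>(3) [OF N], of C] by auto
      then have "C = {\<one>}"
        using openin_normal C by blast
      then have "topspace T \<inter> \<Inter>(\<M> - {N}) \<subseteq> N"
        using subgroup.one_closed [OF normal_imp_subgroup [OF \<M>(2) [OF N]]] topspace_eq_carrier
        by (auto simp: C_def)
      then obtain \<G> where \<G>: "finite \<G>" "\<G> \<subseteq> \<M> - {N}" "topspace T \<inter> \<Inter>\<G> \<subseteq> N"
        using compactin_Inter_subset_open [OF compact [unfolded compact_space_def], of "\<M> - {N}" N]
          \<M>(3,4) N by (metis DiffD1)
      have "\<exists>A\<in>\<G>. A \<subseteq> N"
        using \<G>(2,3) \<M>(2) topspace_eq_carrier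
        by (intro maximal_proper_open_normal_prime_finite [OF \<M>(1) [OF N] max xy \<G>(1)]) auto
      then obtain A where "A \<in> \<M>" "A \<noteq> N" "A \<subseteq> N"
        using \<G>(2) by auto
      then show ?thesis
        using \<M>(1) [OF N] by (auto simp: \<M>_def)
    qed
  qed
qed

end

section \<open>Groups normalizing a compact open subgroup\<close>

context group
begin

lemma inner_aut_image_Inter_fix:
  assumes "g \<in> carrier G" "F \<noteq> {}" "\<And>V. V \<in> F \<Longrightarrow> V \<subseteq> carrier G"
    and "\<And>V. V \<in> F \<Longrightarrow> inner_aut G g ` V = V"
  shows "inner_aut G g ` \<Inter>F = \<Inter>F"
  using inner_aut_image_Inter [OF assms(1,2), of "\<lambda>V. V"] assms(3,4) by simp

lemma normal_in_subgroupI: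
  assumes "subgroup A G" "subgroup N G" "N \<subseteq> A" "\<And>a. a \<in> A \<Longrightarrow> inner_aut G a ` N = N"
  shows "N \<lhd> G\<lparr>carrier := A\<rparr>"
proof -
  interpret GA: group "G\<lparr>carrier := A\<rparr>"
    using assms(1) by (rule subgroup.subgroup_is_group) (rule group_axioms)
  have "subgroup N (G\<lparr>carrier := A\<rparr>)"
    using assms(1-3) by (intro subgroup_incl)
  moreover have "a \<otimes> n \<otimes> inv\<^bsub>G\<lparr>carrier := A\<rparr>\<^esub> a \<in> N" if "a \<in> A" "n \<in> N" for a n
  proof -
    have "inner_aut G a n \<in> N"
      using assms(4) [OF that(1)] that(2) by blast
    then show ?thesis
      using that assms(1) subgroup.mem_carrier [OF assms(2) that(2)]
      by (simp add: inner_aut_apply m_inv_consistent)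
  qed
  ultimately show ?thesis
    by (simp add: GA.normal_inv_iff)
qed

end

section \<open>From the ambient group to its compact open subgroups\<close>

context topological_group
begin

lemma not_open_one:
  assumes "T \<noteq> discrete_topology (carrier G)"
  shows "\<not> openin T {\<one>}"
proof
  assume "openin T {\<one>}"
  then have "openin T {x}" if "x \<in> carrier G" for x
    using that openin_l_coset [OF that, of "{\<one>}"] by (simp add: l_coset_def)
  then have "discrete_topology (carrier G) = T"
    by (simp add: discrete_topology_unique topspace_eq_carrier)
  then show False
    using assms by simp
qed

lemma just_infinite_openin:
  assumes U: "compact_open_subgroup G T U" and JI: "just_infinite G T U"
    and N: "N \<lhd> G\<lparr>carrier := U\<rparr>" "closedin (subtopology T U) N" "N \<noteq> {\<one>}"
  shows "openin (subtopology T U) N"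
proof -
  interpret GU: topological_group "G\<lparr>carrier := U\<rparr>" "subtopology T U"
    using U by (intro topological_group_subgroup) (simp add: compact_open_subgroup_def)
  have "finite (rcosets\<^bsub>G\<lparr>carrier := U\<rparr>\<^esub> N)"
    using JI N by (auto simp: just_infinite_def)
  then show ?thesis
    using N normal_imp_subgroup by (intro GU.openin_closed_finite_index) auto
qed

lemma inner_aut_topological_automorphism:
  assumes "g \<in> carrier G" "subgroup A G" "inner_aut G g ` A = A"
  shows "inner_aut G g \<in> topological_automorphisms (G\<lparr>carrier := A\<rparr>) (subtopology T A)"
proof -
  have sub: "A \<subseteq> carrier G"
    using assms(2) by (rule subgroup.subset)
  have "inner_aut G g \<in> hom (G\<lparr>carrier := A\<rparr>) (G\<lparr>carrier := A\<rparr>)"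
  proof (rule homI)
    fix x y assume xy: "x \<in> carrier (G\<lparr>carrier := A\<rparr>)" "y \<in> carrier (G\<lparr>carrier := A\<rparr>)"
    then show "inner_aut G g (x \<otimes>\<^bsub>G\<lparr>carrier := A\<rparr>\<^esub> y)
        = inner_aut G g x \<otimes>\<^bsub>G\<lparr>carrier := A\<rparr>\<^esub> inner_aut G g y"
      using hom_mult [OF inner_aut_hom [OF assms(1)], of x y] sub by auto
  next
    fix x assume "x \<in> carrier (G\<lparr>carrier := A\<rparr>)"
    then show "inner_aut G g x \<in> carrier (G\<lparr>carrier := A\<rparr>)"
      using assms(3) by auto
  qed
  moreover have "homeomorphic_map (subtopology T A) (subtopology T A) (inner_aut G g)"
    using homeomorphic_map_inner_aut [OF assms(1)] sub assms(3)
    by (intro homeomorphic_map_subtopologies) (auto simp: topspace_eq_carrier Int_absorb1)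
  ultimately show ?thesis
    by (simp add: topological_automorphisms_def)
qed

text \<open>Makes the results on characteristic subgroups available for compact open subgroups. Just
  infiniteness gives \<open>openin_normal\<close> because a closed subgroup of finite index is
  open.\<close>

lemma compact_just_infinite_subgroup:
  assumes "T \<noteq> discrete_topology (carrier G)" "totally_disconnected_space T"
    and U: "compact_open_subgroup G T U" and JI: "just_infinite G T U"
  shows "compact_just_infinite_group (G\<lparr>carrier := U\<rparr>) (subtopology T U)"
proof -
  have sub: "subgroup U G" "openin T U" "compactin T U"
    using U by (auto simp: compact_open_subgroup_def)
  interpret GU: topological_group "G\<lparr>carrier := U\<rparr>" "subtopology T U"
    using sub(1) by (rule topological_group_subgroup)
  show ?thesis
  proof unfold_locales
    show "compact_space (subtopology T U)"
      using sub(3) by (rule compact_space_subtopology)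
    show "totally_disconnected_space (subtopology T U)"
      using assms(2) by (auto simp: totally_disconnected_space_def connectedin_subtopology)
    show "\<not> openin (subtopology T U) {\<one>\<^bsub>G\<lparr>carrier := U\<rparr>\<^esub>}"
      using not_open_one [OF assms(1)] sub(2) by (simp add: openin_open_subtopology)
    show "openin (subtopology T U) N"
      if "N \<lhd> G\<lparr>carrier := U\<rparr>" "closedin (subtopology T U) N" "N \<noteq> {\<one>\<^bsub>G\<lparr>carrier := U\<rparr>\<^esub>}" for N
      using just_infinite_openin [OF U JI] that by simp
  qed
qed

lemma normalized_compact_open_base:
  assumes nd: "T \<noteq> discrete_topology (carrier G)" and td: "totally_disconnected_space T"
    and JI: "\<And>U. compact_open_subgroup G T U \<Longrightarrow> just_infinite G T U"
    and H: "subgroup H G"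
    and U: "compact_open_subgroup G T U" "normalized_by G H U"
  shows "neighbourhood_base_at \<one> (\<lambda>U. compact_open_subgroup G T U \<and> normalized_by G H U) T"
proof -
  have Usub: "subgroup U G" and Uo: "openin T U" and Uc: "compactin T U" and Ucar: "U \<subseteq> carrier G"
    using U(1) by (auto simp: compact_open_subgroup_def dest: subgroup.subset)
  have Hcar: "H \<subseteq> carrier G"
    using H by (rule subgroup.subset)
  \<comment> \<open>Invariance under \<open>U\<close> in addition to \<open>H\<close> makes the
    intersection \<open>R\<close> normal in \<open>U\<close>, so that just infiniteness of
    \<open>U\<close> applies to it.\<close>
  define F where "F = {V. open_subgroup G T V \<and> V \<subseteq> U \<and> (\<forall>g\<in>H \<union> U. inner_aut G g ` V = V)}"
  have Fsub: "subgroup V G" "V \<subseteq> carrier G" "V \<subseteq> U" if "V \<in> F" for V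
    using that by (auto simp: F_def open_subgroup_def dest: subgroup.subset)
  have Fcl: "closedin T V" if "V \<in> F" for V
    using that by (auto simp: F_def intro: closedin_open_subgroup)
  have "inner_aut G g ` U = U" if "g \<in> H \<union> U" for g
    using that U(2) [unfolded normalized_by_iff [OF Ucar]] inner_aut_image_self [OF Usub] by blast
  then have UF: "U \<in> F"
    using U(1) by (simp add: F_def compact_open_imp_open_subgroup)
  have good: "compact_open_subgroup G T V \<and> normalized_by G H V" if "V \<in> F" for V
    using that Fsub(2) [OF that] Hcar compact_open_subgroup_open [OF U(1), of V]
    by (auto simp: F_def normalized_by_iff)
  define R where "R = \<Inter>F"
  have R: "subgroup R G"
    unfolding R_def using UF Fsub(1) by (intro subgroups_Inter) auto
  have RU: "R \<subseteq> U"
    using UF by (auto simp: R_def)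
  have Rinv: "inner_aut G g ` R = R" if "g \<in> H \<union> U" for g
  proof -
    have "g \<in> carrier G"
      using that Hcar Ucar by auto
    then show ?thesis
      unfolding R_def using UF that Fsub(2) by (intro inner_aut_image_Inter_fix) (auto simp: F_def)
  qed
  have Rcl: "closedin T R"
    unfolding R_def using UF Fcl by (intro closedin_Inter) auto
  show ?thesis
  proof (cases "R = {\<one>}")
    case True
    have "\<exists>A V. openin T A \<and> (compact_open_subgroup G T V \<and> normalized_by G H V) \<and>
        \<one> \<in> A \<and> A \<subseteq> V \<and> V \<subseteq> W" if W: "openin T W \<and> \<one> \<in> W" for W
    proof -
      have "U \<inter> \<Inter>F \<subseteq> W"
        using True W by (auto simp: R_def)
      \<comment> \<open>\<open>F\<close> is closed under binary intersections, so compactness of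
        \<open>U\<close> finds a single member inside \<open>W\<close>.\<close>
      moreover have "\<exists>D\<in>F. D \<subseteq> A \<inter> B" if AB: "A \<in> F" "B \<in> F" for A B
      proof -
        have "inner_aut G g ` (A \<inter> B) = A \<inter> B" if g: "g \<in> H \<union> U" for g
        proof -
          have "inner_aut G g ` A = A" "inner_aut G g ` B = B" "g \<in> carrier G"
            using AB g Hcar Ucar by (auto simp: F_def)
          then show ?thesis
            using inner_aut_image_Int [of g A B] Fsub(2) AB by simp
        qed
        then have "A \<inter> B \<in> F"
          using AB open_subgroup_Int by (auto simp: F_def)
        then show ?thesis
          by blast
      qed
      ultimately obtain V where V: "V \<in> F" "U \<inter> V \<subseteq> W"
        using compactin_directed_Inter_subset_open [OF Uc Fcl, of F W] UF W by (metis empty_iff)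
      then have "V \<subseteq> W"
        using Fsub(3) by blast
      moreover have "openin T V" "\<one> \<in> V"
        using V(1) Fsub(1) [OF V(1)] subgroup.one_closed by (auto simp: F_def open_subgroup_def)
      ultimately show ?thesis
        using good [OF V(1)] by blast
    qed
    then show ?thesis
      unfolding neighbourhood_base_at_def by blast
  next
    case False
    have "R \<lhd> G\<lparr>carrier := U\<rparr>"
      using Rinv by (intro normal_in_subgroupI Usub R RU) auto
    moreover have "closedin (subtopology T U) R"
      using Rcl RU by (simp add: closedin_subset_topspace)
    ultimately have "openin (subtopology T U) R"
      using False by (intro just_infinite_openin U(1) JI)
    then have Ro: "openin T R"
      using Uo openin_trans_full by blast
    then have RF: "R \<in> F"
      using R RU Rinv by (auto simp: F_def open_subgroup_def)
    then have Rco: "compact_open_subgroup G T R"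
      using good by blast
    \<comment> \<open>Being compact and open, \<open>R\<close> is itself just infinite and has a
      proper open subgroup \<open>M\<close> that is invariant under its automorphisms.\<close>
    interpret GR: compact_just_infinite_group "G\<lparr>carrier := R\<rparr>" "subtopology T R"
      by (intro compact_just_infinite_subgroup nd td Rco JI)
    obtain M where M: "M \<lhd> G\<lparr>carrier := R\<rparr>" "openin (subtopology T R) M" "M \<noteq> R"
      and inv: "\<And>f. f \<in> topological_automorphisms (G\<lparr>carrier := R\<rparr>) (subtopology T R) \<Longrightarrow> f ` M \<subseteq> M"
      using GR.ex_characteristic_proper_open by (auto simp: proper_open_normals_def)
    have Msub: "subgroup M G"
      using M(1) R normal_imp_subgroup incl_subgroup by blast
    have MR: "M \<subseteq> R"
      using M(2) openin_subset by fastforce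
    \<comment> \<open>Elements of \<open>H\<close> and \<open>U\<close> act on \<open>R\<close> by
      topological automorphisms and so preserve \<open>M\<close>. Thus \<open>M\<close> belongs to
      \<open>F\<close>, although it is strictly smaller than the intersection \<open>R\<close> of
      \<open>F\<close>.\<close>
    have "inner_aut G g ` M = M" if g: "g \<in> H \<union> U" for g
    proof (rule inner_aut_image_fixI)
      have gi: "inv g \<in> H \<union> U"
        using g subgroup.m_inv_closed [OF H] subgroup.m_inv_closed [OF Usub] by auto
      have gc: "g \<in> carrier G" "inv g \<in> carrier G"
        using g Hcar Ucar by auto
      show "g \<in> carrier G" "M \<subseteq> carrier G"
        using gc Msub subgroup.subset by auto
      show "inner_aut G g ` M \<subseteq> M"
        by (intro inv inner_aut_topological_automorphism gc R Rinv g)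
      show "inner_aut G (inv g) ` M \<subseteq> M"
        by (intro inv inner_aut_topological_automorphism gc R Rinv gi)
    qed
    moreover have "openin T M"
      using M(2) Ro openin_trans_full by blast
    ultimately have "M \<in> F"
      using Msub MR RU by (auto simp: F_def open_subgroup_def)
    then have "R \<subseteq> M"
      by (auto simp: R_def)
    then show ?thesis
      using MR M(3) by blast
  qed
qed

end

section \<open>Flat subgroups\<close>

context group
begin

text \<open>The normalizer is a subgroup and contains all powers of its elements.\<close>

lemma inner_aut_image_int_pow_fix:
  assumes "k \<in> carrier G" "V \<subseteq> carrier G" "inner_aut G k ` V = V"
  shows "inner_aut G (k [^] (n::int)) ` V = V"
proof -
  have "subgroup (normalizer G V) G"
    using assms(2) by (rule normalizer_imp_subgroup)
  moreover have "k \<in> normalizer G V"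
    using assms by (simp add: mem_normalizer_iff)
  ultimately have "k [^] n \<in> normalizer G V"
    by (rule subgroup_int_pow_closed)
  then show ?thesis
    using assms(2) by (simp add: mem_normalizer_iff)
qed

lemma inner_aut_image_int_pow_add:
  assumes "k \<in> carrier G" "A \<subseteq> carrier G"
  shows "inner_aut G (k [^] (m::int)) ` inner_aut G (k [^] (n::int)) ` A = inner_aut G (k [^] (m + n)) ` A"
  using assms by (simp add: int_pow_mult inner_aut_image_mult)

lemma tidy_plus_inner_aut:
  "k \<in> carrier G \<Longrightarrow> tidy_plus G (inner_aut G k) U = (\<Inter>n\<in>{n::int. n \<ge> 0}. inner_aut G (k [^] n) ` U)"
  by (simp add: tidy_plus_def inner_aut_int_pow)

lemma tidy_minus_inner_aut:
  "k \<in> carrier G \<Longrightarrow> tidy_minus G (inner_aut G k) U = (\<Inter>n\<in>{n::int. n \<le> 0}. inner_aut G (k [^] n) ` U)"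
  by (simp add: tidy_minus_def inner_aut_int_pow)

text \<open>Replacing \<open>k\<close> by its inverse exchanges \<open>U\<^sub>+\<close> and
  \<open>U\<^sub>-\<close>, so statements about one transfer to the other.\<close>

lemma tidy_minus_eq_tidy_plus_inv:
  assumes "k \<in> carrier G"
  shows "tidy_minus G (inner_aut G k) U = tidy_plus G (inner_aut G (inv k)) U"
proof -
  have "inv k [^] (n::int) = k [^] (- n)" for n
    using assms by (simp add: int_pow_inv int_pow_neg)
  then have "tidy_plus G (inner_aut G (inv k)) U
      = (\<Inter>n\<in>{n::int. n \<ge> 0}. inner_aut G (k [^] (- n)) ` U)"
    using assms by (simp add: tidy_plus_inner_aut)
  also have "\<dots> = (\<Inter>n\<in>uminus ` {n::int. n \<ge> 0}. inner_aut G (k [^] n) ` U)"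
    by simp
  also have "uminus ` {n::int. n \<ge> 0} = {n. n \<le> 0}"
    by (auto simp: image_iff intro!: exI [of _ "- _"])
  finally show ?thesis
    using assms by (simp add: tidy_minus_inner_aut)
qed

end

text \<open>For a subset \<open>U\<close> of the carrier this is the intersection of
  \<open>U\<^sub>+\<close> and \<open>U\<^sub>-\<close>, equivalently the largest subset of
  \<open>U\<close> fixed by conjugation with \<open>k\<close>.\<close>

definition conj_core :: "('a, 'b) monoid_scheme \<Rightarrow> 'a \<Rightarrow> 'a set \<Rightarrow> 'a set" where
  "conj_core G k U = (\<Inter>n::int. inner_aut G (k [^]\<^bsub>G\<^esub> n) ` U)"

context group
begin

lemma conj_core_inv:
  assumes "k \<in> carrier G"
  shows "conj_core G (inv k) U = conj_core G k U"
proof -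
  have "inv k [^] (n::int) = k [^] (- n)" for n
    using assms by (simp add: int_pow_inv int_pow_neg)
  then have "conj_core G (inv k) U = (\<Inter>n\<in>range uminus. inner_aut G (k [^] (n::int)) ` U)"
    by (simp only: conj_core_def image_image)
  also have "range uminus = (UNIV :: int set)"
    by (rule surjI [of uminus uminus]) simp
  finally show ?thesis
    by (simp only: conj_core_def)
qed

lemma conj_core_subset:
  assumes "U \<subseteq> carrier G"
  shows "conj_core G k U \<subseteq> U"
proof -
  have "conj_core G k U \<subseteq> inner_aut G (k [^] (0::int)) ` U"
    unfolding conj_core_def by blast
  then show ?thesis
    using assms by (simp add: inner_aut_image_one)
qed

lemma subgroup_conj_core:
  assumes "k \<in> carrier G" "subgroup U G"
  shows "subgroup (conj_core G k U) G"
  unfolding conj_core_def using assms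
  by (intro subgroups_Inter) (auto intro: subgroup_inner_aut_image)

lemma inner_aut_image_conj_core:
  assumes "k \<in> carrier G" "U \<subseteq> carrier G"
  shows "inner_aut G k ` conj_core G k U = conj_core G k U"
proof -
  have "inner_aut G k ` conj_core G k U
      = (\<Inter>n::int. inner_aut G (k [^] (1::int)) ` inner_aut G (k [^] n) ` U)"
    unfolding conj_core_def using assms inner_aut_image_subset
    by (subst inner_aut_image_Inter) auto
  also have "\<dots> = (\<Inter>n. inner_aut G (k [^] (1 + n :: int)) ` U)"
    using assms by (simp only: inner_aut_image_int_pow_add)
  also have "\<dots> = (\<Inter>n\<in>range (\<lambda>n. 1 + n). inner_aut G (k [^] (n::int)) ` U)"
    by (simp only: image_image)
  also have "range (\<lambda>n::int. 1 + n) = UNIV"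
    by (auto intro: range_eqI [of _ _ "_ - 1"])
  finally show ?thesis
    by (simp add: conj_core_def)
qed

end

section \<open>Contraction towards the core and invariant open subgroups\<close>

context topological_group
begin

lemma closedin_compact_open_subgroup: "compact_open_subgroup G T U \<Longrightarrow> closedin T U"
  by (intro closedin_open_subgroup compact_open_imp_open_subgroup)

lemma closedin_inner_aut_image: "\<lbrakk>g \<in> carrier G; closedin T A\<rbrakk> \<Longrightarrow> closedin T (inner_aut G g ` A)"
  using homeomorphic_imp_closed_map [OF homeomorphic_map_inner_aut] by (auto simp: closed_map_def)

lemma closedin_conj_core:
  assumes "k \<in> carrier G" "closedin T U"
  shows "closedin T (conj_core G k U)"
  unfolding conj_core_def using assms
  by (intro closedin_Inter) (auto intro: closedin_inner_aut_image)

text \<open>Conjugation by large negative powers of \<open>k\<close> contracts \<open>U\<^sub>+\<close> into any neighbourhood of the core.\<close>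

lemma tidy_plus_subset_core_mult:
  assumes U: "compact_open_subgroup G T U" and k: "k \<in> carrier G"
    and V: "open_subgroup G T V" "inner_aut G k ` V = V"
  shows "tidy_plus G (inner_aut G k) U \<subseteq> V <#> conj_core G k U"
proof -
  let ?c = "\<lambda>n::int. inner_aut G (k [^] n)"
  have Ucl: "closedin T U" and Uc: "compactin T U" and Ucar: "U \<subseteq> carrier G" and Usub: "subgroup U G"
    using U closedin_compact_open_subgroup by (auto simp: compact_open_subgroup_def dest: subgroup.subset)
  have Vcar: "V \<subseteq> carrier G" and Vsub: "subgroup V G" and Vo: "openin T V"
    using V(1) by (auto simp: open_subgroup_def dest: subgroup.subset)
  \<comment> \<open>An open set that contains the core and is invariant under conjugation by every
    power of \<open>k\<close>.\<close>
  define W where "W = V <#> conj_core G k U"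
  have core_car: "conj_core G k U \<subseteq> carrier G"
    using conj_core_subset [OF Ucar] Ucar by blast
  have "openin T W"
    unfolding W_def using core_car Vo by (rule openin_set_mult(2))
  have W_inv: "?c n ` W = W" for n
  proof -
    have "?c n ` V = V" "?c n ` conj_core G k U = conj_core G k U"
      using k Vcar V(2) core_car inner_aut_image_conj_core [OF k Ucar]
      by (simp_all add: inner_aut_image_int_pow_fix)
    then show ?thesis
      unfolding W_def using k Vcar core_car by (simp add: inner_aut_image_set_mult)
  qed
  have "conj_core G k U \<subseteq> W"
  proof
    fix x assume "x \<in> conj_core G k U"
    moreover from this have "x = \<one> \<otimes> x"
      using core_car by auto
    ultimately show "x \<in> W"
      unfolding W_def set_mult_def using subgroup.one_closed [OF Vsub] by blast
  qed
  then have "U \<inter> \<Inter>(range (\<lambda>n. ?c n ` U)) \<subseteq> W"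
    by (auto simp: conj_core_def)
  moreover have "closedin T F" if "F \<in> range (\<lambda>n. ?c n ` U)" for F
    using that k Ucl by (auto intro: closedin_inner_aut_image)
  ultimately obtain \<G> where \<G>: "finite \<G>" "\<G> \<subseteq> range (\<lambda>n. ?c n ` U)" "U \<inter> \<Inter>\<G> \<subseteq> W"
    using compactin_Inter_subset_open [OF Uc _ \<open>openin T W\<close>, of "range (\<lambda>n. ?c n ` U)"] by metis
  obtain I where I: "finite I" "\<G> = (\<lambda>n. ?c n ` U) ` I"
    using finite_subset_image [OF \<G>(1,2)] by blast
  \<comment> \<open>Compactness leaves the finite set \<open>I\<close> of exponents to control.
    Including 0 ensures that \<open>N\<close> is nonpositive and that the conjugate \<open>y\<close>
    lies in \<open>U\<close> itself.\<close>
  define N where "N = Min (insert 0 I)"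
  have N: "N \<le> n" if "n \<in> insert 0 I" for n
    unfolding N_def using I(1) that by (intro Min_le) auto
  show ?thesis
  proof
    fix x assume "x \<in> tidy_plus G (inner_aut G k) U"
    then have x: "x \<in> ?c n ` U" if "n \<ge> 0" for n
      using that k by (simp add: tidy_plus_inner_aut)
    have "x \<in> ?c 0 ` U"
      by (rule x) simp
    then have xc: "x \<in> carrier G"
      using Ucar by (auto simp: inner_aut_image_one)
    \<comment> \<open>For \<open>n\<close> in \<open>insert 0 I\<close> the difference
      \<open>n - N\<close> is nonnegative, so \<open>x\<close> lies in the corresponding conjugate
      of \<open>U\<close> and \<open>y\<close> in the \<open>n\<close>-th one. Hence
      \<open>y\<close> is in \<open>W\<close>, and invariance of \<open>W\<close> brings
      \<open>x\<close> back into \<open>W\<close>.\<close>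
    define y where "y = ?c N x"
    have y: "y \<in> ?c n ` U" if "n \<in> insert 0 I" for n
    proof -
      have "x \<in> ?c (n - N) ` U"
        using N [OF that] by (intro x) simp
      then have "y \<in> ?c N ` ?c (n - N) ` U"
        unfolding y_def by (rule imageI)
      then show ?thesis
        using k Ucar by (simp add: inner_aut_image_int_pow_add)
    qed
    have "y \<in> U"
      using y [of 0] Ucar by (simp add: inner_aut_image_one)
    then have "y \<in> W"
      using \<G>(3) y by (auto simp: I(2))
    then have "?c (- N) y \<in> ?c (- N) ` W"
      by (rule imageI)
    then have "?c (- N) y \<in> W"
      by (simp only: W_inv)
    moreover have "?c (- N) y = x"
      using k xc by (simp add: y_def inner_aut_mult [symmetric] int_pow_mult [symmetric] inner_aut_one)
    ultimately show "x \<in> V <#> conj_core G k U"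
      by (simp add: W_def)
  qed
qed

lemma tidy_minus_subset_core_mult:
  assumes U: "compact_open_subgroup G T U" and k: "k \<in> carrier G"
    and V: "open_subgroup G T V" "inner_aut G k ` V = V"
  shows "tidy_minus G (inner_aut G k) U \<subseteq> V <#> conj_core G k U"
proof -
  have "inner_aut G (inv k) ` V = V"
    using k V subgroup.subset by (intro inner_aut_image_eq_inv) (auto simp: open_subgroup_def)
  then show ?thesis
    using tidy_plus_subset_core_mult [OF U _ V(1), of "inv k"] k
    by (simp add: tidy_minus_eq_tidy_plus_inv conj_core_inv)
qed

text \<open>The intersection of the conjugates of \<open>V\<close> by elements of the core is open,
  because the compact core produces only finitely many. Since \<open>k\<close> normalizes the core,
  it permutes these conjugates.\<close>

lemma ex_core_invariant_subgroup:
  assumes U: "compact_open_subgroup G T U" and k: "k \<in> carrier G"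
    and V: "open_subgroup G T V" "inner_aut G k ` V = V"
  obtains V' where "open_subgroup G T V'" "inner_aut G k ` V' = V'" "V' \<subseteq> V"
    "\<And>u. u \<in> conj_core G k U \<Longrightarrow> inner_aut G u ` V' = V'"
proof -
  define C where "C = conj_core G k U"
  have Ucar: "U \<subseteq> carrier G" and Usub: "subgroup U G" and Uc: "compactin T U"
    using U by (auto simp: compact_open_subgroup_def dest: subgroup.subset)
  have Vcar: "V \<subseteq> carrier G"
    using V(1) by (auto simp: open_subgroup_def dest: subgroup.subset)
  have C: "subgroup C G"
    unfolding C_def using k Usub by (rule subgroup_conj_core)
  then have Ccar: "C \<subseteq> carrier G"
    by (rule subgroup.subset)
  have Ck: "inner_aut G k ` C = C"
    unfolding C_def using k Ucar by (rule inner_aut_image_conj_core)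
  have "closedin T C"
    unfolding C_def using k closedin_compact_open_subgroup [OF U] by (rule closedin_conj_core)
  then have "compactin T C"
    using closed_compactin [OF Uc] conj_core_subset [OF Ucar] by (simp add: C_def)
  then have fin: "finite ((\<lambda>u. inner_aut G u ` V) ` C)"
    using V(1) by (rule finite_inner_aut_images)
  have ne: "C \<noteq> {}"
    using subgroup.one_closed [OF C] by auto
  define V' where "V' = (\<Inter>u\<in>C. inner_aut G u ` V)"
  have sub: "inner_aut G u ` V \<subseteq> carrier G" if "u \<in> C" for u
    using that Ccar Vcar by (intro inner_aut_image_subset) auto
  have "open_subgroup G T V'"
    unfolding V'_def using fin ne V(1) Ccar
    by (intro open_subgroup_finite_Inter) (auto intro: open_subgroup_inner_aut_image)
  moreover have "inner_aut G k ` V' = V'"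
  proof -
    \<comment> \<open>As \<open>k\<close> fixes \<open>V\<close>, conjugating \<open>V\<close> by
      \<open>k \<otimes> u\<close> is the same as conjugating it by the core element
      \<open>inner_aut G k u\<close>.\<close>
    have "inner_aut G k ` inner_aut G u ` V = inner_aut G (inner_aut G k u) ` V" if "u \<in> C" for u
    proof -
      have u: "u \<in> carrier G"
        using that Ccar by blast
      have "inner_aut G (inner_aut G k u) ` V = inner_aut G (inner_aut G k u) ` inner_aut G k ` V"
        by (simp only: V(2))
      also have "\<dots> = inner_aut G (inner_aut G k u \<otimes> k) ` V"
        using k u Vcar by (simp add: inner_aut_image_mult inner_aut_closed)
      also have "inner_aut G k u \<otimes> k = k \<otimes> u"
        using k u by (simp add: inner_aut_apply m_assoc)
      also have "inner_aut G (k \<otimes> u) ` V = inner_aut G k ` inner_aut G u ` V"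
        using k u Vcar by (rule inner_aut_image_mult)
      finally show ?thesis ..
    qed
    then have "inner_aut G k ` V' = (\<Inter>u\<in>C. inner_aut G (inner_aut G k u) ` V)"
      unfolding V'_def using inner_aut_image_Inter [OF k ne sub] by simp
    also have "\<dots> = (\<Inter>u\<in>inner_aut G k ` C. inner_aut G u ` V)"
      by (simp only: image_image)
    finally show ?thesis
      by (simp only: Ck V'_def)
  qed
  moreover have "V' \<subseteq> V"
    using subgroup.one_closed [OF C] inner_aut_image_one [OF Vcar] by (auto simp: V'_def)
  moreover have "inner_aut G w ` V' = V'" if w: "w \<in> conj_core G k U" for w
  proof -
    have wC: "w \<in> C" "w \<in> carrier G"
      using w Ccar by (auto simp: C_def)
    have "inner_aut G w ` V' = (\<Inter>u\<in>C. inner_aut G w ` inner_aut G u ` V)"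
      unfolding V'_def using wC(2) ne sub by (rule inner_aut_image_Inter)
    also have "\<dots> = (\<Inter>u\<in>C. inner_aut G (w \<otimes> u) ` V)"
    proof (rule INF_cong)
      fix u assume "u \<in> C"
      then have "u \<in> carrier G"
        using Ccar by auto
      with wC(2) show "inner_aut G w ` inner_aut G u ` V = inner_aut G (w \<otimes> u) ` V"
        using Vcar by (rule inner_aut_image_mult [symmetric])
    qed simp
    also have "\<dots> = (\<Inter>u\<in>(\<lambda>u. w \<otimes> u) ` C. inner_aut G u ` V)"
      by (simp only: image_image)
    also have "(\<lambda>u. w \<otimes> u) ` C = C"
    proof
      show "(\<lambda>u. w \<otimes> u) ` C \<subseteq> C"
        using subgroup.m_closed [OF C wC(1)] by auto
      show "C \<subseteq> (\<lambda>u. w \<otimes> u) ` C"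
      proof
        fix u assume u: "u \<in> C"
        then have "inv w \<otimes> u \<in> C"
          using subgroup.m_closed [OF C] subgroup.m_inv_closed [OF C wC(1)] by simp
        moreover have "u = w \<otimes> (inv w \<otimes> u)"
          using u wC(2) Ccar by (auto simp: m_assoc [symmetric])
        ultimately show "u \<in> (\<lambda>u. w \<otimes> u) ` C"
          by (rule rev_image_eqI)
      qed
    qed
    finally show ?thesis
      by (simp only: V'_def)
  qed
  ultimately show thesis
    by (rule that)
qed

text \<open>The witness \<open>D\<close> is \<open>R \<inter> U\<close>, where \<open>R\<close> is
  the intersection of all open subgroups invariant under both \<open>k\<close> and the core
  \<open>C\<close>. It is a nontrivial closed normal subgroup of \<open>U\<close>, hence
  open.\<close>

lemma ex_open_subset_invariant_open_subgroups:
  assumes U: "compact_open_subgroup G T U" and JI: "just_infinite G T U"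
    and k: "k \<in> carrier G"
    and factor: "U = tidy_plus G (inner_aut G k) U <#> tidy_minus G (inner_aut G k) U"
    and moved: "inner_aut G k ` U \<noteq> U"
  obtains D where "openin T D" "\<one> \<in> D"
    "\<And>V. \<lbrakk>open_subgroup G T V; inner_aut G k ` V = V\<rbrakk> \<Longrightarrow> D \<subseteq> V"
proof -
  have Ucar: "U \<subseteq> carrier G" and Usub: "subgroup U G" and Uc: "compactin T U" and Uo: "openin T U"
    using U by (auto simp: compact_open_subgroup_def dest: subgroup.subset)
  have Ucl: "closedin T U"
    using U by (rule closedin_compact_open_subgroup)
  define C where "C = conj_core G k U"
  have C: "subgroup C G"
    unfolding C_def using k Usub by (rule subgroup_conj_core)
  have CU: "C \<subseteq> U"
    unfolding C_def using Ucar by (rule conj_core_subset)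
  then have Ccar: "C \<subseteq> carrier G"
    using Ucar by auto
  have "closedin T C"
    unfolding C_def using k Ucl by (rule closedin_conj_core)
  then have Cc: "compactin T C"
    using closed_compactin [OF Uc CU] by simp
  define \<V> where "\<V> = {V. open_subgroup G T V \<and> inner_aut G k ` V = V \<and> (\<forall>u\<in>C. inner_aut G u ` V = V)}"
  have Vsub: "subgroup V G" "V \<subseteq> carrier G" "closedin T V" if "V \<in> \<V>" for V
    using that closedin_open_subgroup by (auto simp: \<V>_def open_subgroup_def dest: subgroup.subset)
  \<comment> \<open>Both factors of an element of \<open>U\<close> lie in the product of
    \<open>V\<close> and \<open>C\<close>; as \<open>C\<close> normalizes \<open>V\<close>, the
    inner core element can be moved to the right.\<close>
  have U_subset: "U \<subseteq> V <#> C" if V: "V \<in> \<V>" for V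
  proof
    fix u assume "u \<in> U"
    then have "u \<in> tidy_plus G (inner_aut G k) U <#> tidy_minus G (inner_aut G k) U"
      using factor by simp
    then obtain a b where ab: "a \<in> tidy_plus G (inner_aut G k) U" "b \<in> tidy_minus G (inner_aut G k) U"
      "u = a \<otimes> b"
      unfolding set_mult_def by blast
    have Vo: "open_subgroup G T V" "inner_aut G k ` V = V"
      using V by (auto simp: \<V>_def)
    have "a \<in> V <#> C" "b \<in> V <#> C"
      using ab tidy_plus_subset_core_mult [OF U k Vo] tidy_minus_subset_core_mult [OF U k Vo]
      unfolding C_def by blast+
    then obtain v1 c1 v2 c2 where vc: "v1 \<in> V" "c1 \<in> C" "a = v1 \<otimes> c1" "v2 \<in> V" "c2 \<in> C" "b = v2 \<otimes> c2"
      unfolding set_mult_def by blast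
    have car: "v1 \<in> carrier G" "c1 \<in> carrier G" "v2 \<in> carrier G" "c2 \<in> carrier G"
      using vc Vsub(2) [OF V] Ccar by auto
    have "inner_aut G c1 ` V = V"
      using V vc(2) by (auto simp: \<V>_def)
    then have "inner_aut G c1 v2 \<in> V"
      using vc(4) by blast
    then have "v1 \<otimes> inner_aut G c1 v2 \<in> V"
      using vc(1) by (intro subgroup.m_closed [OF Vsub(1) [OF V]])
    moreover have "c1 \<otimes> c2 \<in> C"
      using vc(2,5) by (rule subgroup.m_closed [OF C])
    moreover have "u = (v1 \<otimes> inner_aut G c1 v2) \<otimes> (c1 \<otimes> c2)"
    proof -
      have "inner_aut G c1 v2 \<otimes> (c1 \<otimes> c2) = c1 \<otimes> v2 \<otimes> (inv c1 \<otimes> (c1 \<otimes> c2))"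
        using car by (simp add: inner_aut_apply m_assoc)
      also have "inv c1 \<otimes> (c1 \<otimes> c2) = c2"
        using car by (simp add: m_assoc [symmetric])
      finally show ?thesis
        using car ab(3) vc(3,6) by (simp add: m_assoc inner_aut_closed)
    qed
    ultimately show "u \<in> V <#> C"
      unfolding set_mult_def by blast
  qed
  have "carrier G \<in> \<V>"
  proof -
    have "inner_aut G g ` carrier G = carrier G" if "g \<in> carrier G" for g
      using inner_aut_image_self [OF subgroup_self that] .
    then show ?thesis
      using k Ccar openin_topspace [of T] subgroup_self
      by (auto simp: \<V>_def open_subgroup_def topspace_eq_carrier simp del: openin_topspace)
  qed
  then have ne: "\<V> \<noteq> {}"
    by auto
  have Int: "A \<inter> B \<in> \<V>" if "A \<in> \<V>" "B \<in> \<V>" for A B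
  proof -
    have "inner_aut G g ` (A \<inter> B) = A \<inter> B" if "g \<in> insert k C" for g
    proof -
      have "inner_aut G g ` V = V" if "V \<in> \<V>" for V
        using that \<open>g \<in> insert k C\<close> by (cases "g = k") (simp_all add: \<V>_def)
      moreover have "g \<in> carrier G"
        using that k Ccar by auto
      ultimately show ?thesis
        using inner_aut_image_Int Vsub(2) \<open>A \<in> \<V>\<close> \<open>B \<in> \<V>\<close> by simp
    qed
    then show ?thesis
      using that open_subgroup_Int by (simp add: \<V>_def)
  qed
  define R where "R = \<Inter>\<V>"
  have R: "subgroup R G"
    unfolding R_def using ne Vsub(1) by (intro subgroups_Inter) auto
  have Rcar: "R \<subseteq> carrier G"
    using R by (rule subgroup.subset)
  have Rcl: "closedin T R"
    unfolding R_def using ne Vsub(3) by (intro closedin_Inter) auto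
  \<comment> \<open>Compactness exchanges the intersection over \<open>V\<close> with the product.
    The sets \<open>C \<inter> (V #> u)\<close> are nonempty, compact and directed, so some
    \<open>c\<close> lies in all of them, and then \<open>c \<otimes> inv u\<close> lies in
    \<open>R\<close>.\<close>
  have U_RC: "\<exists>r\<in>R. \<exists>c\<in>C. u = r \<otimes> c" if u: "u \<in> U" for u
  proof -
    have uc: "u \<in> carrier G"
      using u Ucar by auto
    have "C \<inter> (\<Inter>V\<in>\<V>. V #> u) \<noteq> {}"
    proof
      assume "C \<inter> (\<Inter>V\<in>\<V>. V #> u) = {}"
      then have empty: "C \<inter> \<Inter>((\<lambda>V. V #> u) ` \<V>) \<subseteq> {}"
        by simp
      have closed: "closedin T F" if "F \<in> (\<lambda>V. V #> u) ` \<V>" for F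
        using that uc Vsub(3) by (auto intro: closedin_r_coset)
      have directed: "\<exists>D\<in>(\<lambda>V. V #> u) ` \<V>. D \<subseteq> A \<inter> B"
        if AB: "A \<in> (\<lambda>V. V #> u) ` \<V>" "B \<in> (\<lambda>V. V #> u) ` \<V>" for A B
      proof -
        obtain A' B' where A'B': "A' \<in> \<V>" "B' \<in> \<V>" "A = A' #> u" "B = B' #> u"
          using AB by auto
        then have "(A' \<inter> B') #> u \<subseteq> A \<inter> B"
          by (auto simp: r_coset_def)
        then show ?thesis
          using Int [OF A'B'(1,2)] by blast
      qed
      have "(\<lambda>V. V #> u) ` \<V> \<noteq> {}"
        using ne by simp
      then obtain F where "F \<in> (\<lambda>V. V #> u) ` \<V>" "C \<inter> F \<subseteq> {}"
        using compactin_directed_Inter_subset_open [OF Cc closed openin_empty empty _ directed] by blast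
      then obtain V where V: "V \<in> \<V>" "C \<inter> (V #> u) = {}"
        by auto
      obtain v c where vc: "v \<in> V" "c \<in> C" "u = v \<otimes> c"
        using U_subset [OF V(1)] u unfolding set_mult_def by blast
      have "c = inv v \<otimes> u"
        using vc Vsub(2) [OF V(1)] Ccar by (auto simp: m_assoc [symmetric] subset_iff)
      moreover have "inv v \<in> V"
        using vc(1) by (rule subgroup.m_inv_closed [OF Vsub(1) [OF V(1)]])
      ultimately have "c \<in> V #> u"
        unfolding r_coset_def by blast
      then show False
        using V(2) vc(2) by blast
    qed
    then obtain c where c: "c \<in> C" "\<And>V. V \<in> \<V> \<Longrightarrow> c \<in> V #> u"
      by auto
    have cc: "c \<in> carrier G"
      using c(1) Ccar by auto
    have "c \<otimes> inv u \<in> R"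
    proof -
      have "c \<otimes> inv u \<in> V" if V: "V \<in> \<V>" for V
      proof -
        obtain v where v: "v \<in> V" "c = v \<otimes> u"
          using c(2) [OF V] by (auto simp: r_coset_def)
        then have "v \<in> carrier G"
          using Vsub(2) [OF V] by auto
        then have "c \<otimes> inv u = v"
          using v(2) uc by (simp add: m_assoc)
        then show ?thesis
          using v(1) by simp
      qed
      then show ?thesis
        by (simp add: R_def)
    qed
    then have "inv (c \<otimes> inv u) \<in> R"
      by (rule subgroup.m_inv_closed [OF R])
    moreover have "u = inv (c \<otimes> inv u) \<otimes> c"
      using uc cc by (simp add: inv_mult_group m_assoc)
    ultimately show ?thesis
      using c(1) by blast
  qed
  \<comment> \<open>Writing \<open>u\<close> as \<open>r \<otimes> c\<close>, both \<open>r\<close>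
    in \<open>R\<close> and \<open>c\<close> in the core normalize \<open>R\<close>.\<close>
  have R_inv: "inner_aut G u ` R = R" if u: "u \<in> U" for u
  proof -
    obtain r c where rc: "r \<in> R" "c \<in> C" "u = r \<otimes> c"
      using U_RC [OF u] by blast
    have "c \<in> carrier G" "r \<in> carrier G"
      using rc Ccar Rcar by auto
    moreover have "inner_aut G c ` R = R"
      unfolding R_def using \<open>c \<in> carrier G\<close> ne Vsub(2) rc(2)
      by (intro inner_aut_image_Inter_fix) (auto simp: \<V>_def)
    ultimately show ?thesis
      using rc inner_aut_image_self [OF R rc(1)] Rcar by (simp add: inner_aut_image_mult)
  qed
  have D: "subgroup (R \<inter> U) G"
    using R Usub by (rule subgroups_Inter_pair)
  have "R \<inter> U \<lhd> G\<lparr>carrier := U\<rparr>"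
  proof (rule normal_in_subgroupI [OF Usub D])
    fix u assume u: "u \<in> U"
    then have "u \<in> carrier G"
      using Ucar by auto
    then show "inner_aut G u ` (R \<inter> U) = R \<inter> U"
      using R_inv [OF u] inner_aut_image_self [OF Usub u] Rcar Ucar by (simp add: inner_aut_image_Int)
  qed simp
  moreover have "closedin (subtopology T U) (R \<inter> U)"
    using Rcl by (auto simp: closedin_subtopology)
  \<comment> \<open>Otherwise each \<open>u = r \<otimes> c\<close> would have
    \<open>r = u \<otimes> inv c\<close> in the trivial group \<open>R \<inter> U\<close>. Then
    \<open>U\<close> would equal its core, which \<open>k\<close> fixes, against
    \<open>moved\<close>.\<close>
  moreover have "R \<inter> U \<noteq> {\<one>}"
  proof
    assume triv: "R \<inter> U = {\<one>}"
    have "U \<subseteq> C"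
    proof
      fix u assume u: "u \<in> U"
      obtain r c where rc: "r \<in> R" "c \<in> C" "u = r \<otimes> c"
        using U_RC [OF u] by blast
      have car: "r \<in> carrier G" "c \<in> carrier G"
        using rc Rcar Ccar by auto
      have "u \<otimes> inv c \<in> U"
        using u rc(2) CU subgroup.m_closed [OF Usub] subgroup.m_inv_closed [OF Usub] by blast
      moreover have "u \<otimes> inv c = r"
        using rc(3) car by (simp add: m_assoc)
      ultimately have "r = \<one>"
        using triv rc(1) by auto
      then show "u \<in> C"
        using rc car by simp
    qed
    then have "U = C"
      using CU by auto
    then show False
      using moved inner_aut_image_conj_core [OF k Ucar] by (simp add: C_def)
  qed
  ultimately have "openin (subtopology T U) (R \<inter> U)"
    by (intro just_infinite_openin U JI)
  then have "openin T (R \<inter> U)"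
    using Uo openin_trans_full by blast
  moreover have "\<one> \<in> R \<inter> U"
    using D by (rule subgroup.one_closed)
  \<comment> \<open>A subgroup invariant only under \<open>k\<close> is first shrunk to one that is
    also invariant under the core.\<close>
  moreover have "R \<inter> U \<subseteq> V" if V: "open_subgroup G T V" "inner_aut G k ` V = V" for V
  proof -
    obtain V' where "open_subgroup G T V'" "inner_aut G k ` V' = V'" "V' \<subseteq> V"
        "\<And>u. u \<in> conj_core G k U \<Longrightarrow> inner_aut G u ` V' = V'"
      using ex_core_invariant_subgroup [OF U k V] by metis
    then have "V' \<in> \<V>" "V' \<subseteq> V"
      by (auto simp: \<V>_def C_def)
    then show ?thesis
      by (auto simp: R_def)
  qed
  ultimately show thesis
    by (rule that)
qed

text \<open>The conjugate of \<open>U\<close> by \<open>h\<close> depends only on the coset of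
  \<open>h\<close> modulo \<open>K\<close> and is locally constant in \<open>h\<close>. Compactness
  of the coset space therefore leaves finitely many conjugates, whose intersection is
  \<open>W\<close>.\<close>

lemma cocompact_normalized_compact_open:
  assumes H: "subgroup H G" and K: "cocompact_closed_subgroup G T H K"
    and U: "compact_open_subgroup G T U" and inv: "\<And>k. k \<in> K \<Longrightarrow> inner_aut G k ` U = U"
  obtains W where "compact_open_subgroup G T W" "normalized_by G H W"
proof -
  have Ucar: "U \<subseteq> carrier G" and Usub: "subgroup U G" and Uo: "openin T U"
    using U by (auto simp: compact_open_subgroup_def dest: subgroup.subset)
  have Hcar: "H \<subseteq> carrier G"
    using H by (rule subgroup.subset)
  have KH: "subgroup K (G\<lparr>carrier := H\<rparr>)" and comp: "compact_space (coset_space G T H K)"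
    using K by (auto simp: cocompact_closed_subgroup_def closed_subgroup_def)
  have Ksub: "subgroup K G"
    using H KH by (rule incl_subgroup)
  then have Kcar: "K \<subseteq> carrier G"
    by (rule subgroup.subset)
  define f where "f = (\<lambda>h. h <# K)"
  \<comment> \<open>The fibres of the map from \<open>h\<close> to its conjugate of
    \<open>U\<close>; they are open in \<open>H\<close> and saturated for the quotient map
    \<open>f\<close>.\<close>
  define P where "P A = {h \<in> H. inner_aut G h ` U = A}" for A
  have topH: "topspace (subtopology T H) = H"
    using Hcar by (auto simp: topspace_eq_carrier)
  have top: "topspace (coset_space G T H K) = f ` H"
    by (simp add: coset_space_def topspace_quotient_topology topH f_def del: topspace_subtopology)
  have P_f: "x \<in> P A" if x: "x \<in> H" "f x \<in> f ` P A" for x A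
  proof -
    obtain p where p: "p \<in> H" "inner_aut G p ` U = A" "x <# K = p <# K"
      using x(2) by (auto simp: P_def f_def)
    have "x \<in> x <# K"
      using subgroup.one_closed [OF Ksub] x(1) Hcar by (force simp: l_coset_def)
    then obtain k where "k \<in> K" "x = p \<otimes> k"
      unfolding p(3) by (auto simp: l_coset_def)
    then have "inner_aut G x ` U = A"
      using p Hcar Kcar Ucar inv by (auto simp: inner_aut_image_mult subset_iff)
    then show ?thesis
      using x(1) by (simp add: P_def)
  qed
  have "openin (coset_space G T H K) (f ` P A)" for A
  proof -
    have Pcar: "P A \<subseteq> carrier G"
      using Hcar by (auto simp: P_def)
    \<comment> \<open>Since \<open>U\<close> normalizes itself, right multiplication by
      \<open>U\<close> does not change the conjugate; this displays the fibre as relatively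
      open.\<close>
    have "P A = (P A <#> U) \<inter> H"
    proof
      show "P A \<subseteq> (P A <#> U) \<inter> H"
      proof
        fix p assume p: "p \<in> P A"
        then have "p = p \<otimes> \<one>"
          using Pcar by auto
        then have "p \<in> P A <#> U"
          unfolding set_mult_def using p subgroup.one_closed [OF Usub] by blast
        then show "p \<in> (P A <#> U) \<inter> H"
          using p by (simp add: P_def)
      qed
      show "(P A <#> U) \<inter> H \<subseteq> P A"
      proof
        fix x assume x: "x \<in> (P A <#> U) \<inter> H"
        then obtain p u where pu: "p \<in> P A" "u \<in> U" "x = p \<otimes> u"
          by (auto simp: set_mult_def)
        then have "inner_aut G x ` U = inner_aut G p ` U"
          using Pcar Ucar inner_aut_image_self [OF Usub pu(2)] by (auto simp: inner_aut_image_mult subset_iff)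
        then show "x \<in> P A"
          using x pu(1) by (simp add: P_def)
      qed
    qed
    moreover have "openin T (P A <#> U)"
      using Pcar Uo by (rule openin_set_mult(1))
    ultimately have "openin (subtopology T H) (P A)"
      unfolding openin_subtopology by blast
    moreover have "{x \<in> topspace (subtopology T H). f x \<in> f ` P A} = P A"
    proof
      show "{x \<in> topspace (subtopology T H). f x \<in> f ` P A} \<subseteq> P A"
      proof
        fix x assume "x \<in> {x \<in> topspace (subtopology T H). f x \<in> f ` P A}"
        then show "x \<in> P A"
          unfolding topH by (intro P_f) simp_all
      qed
      show "P A \<subseteq> {x \<in> topspace (subtopology T H). f x \<in> f ` P A}"
        unfolding topH by (auto simp: P_def)
    qed
    moreover have "f ` P A \<subseteq> f ` topspace (subtopology T H)"
      unfolding topH by (auto simp: P_def)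
    ultimately show ?thesis
      unfolding coset_space_def f_def by (simp only: openin_quotient_topology)
  qed
  then have "openin (coset_space G T H K) B" if "B \<in> range (\<lambda>A. f ` P A)" for B
    using that by auto
  moreover have "topspace (coset_space G T H K) \<subseteq> \<Union>(range (\<lambda>A. f ` P A))"
    unfolding top by (auto simp: P_def)
  ultimately obtain \<F> where \<F>: "finite \<F>" "\<F> \<subseteq> range (\<lambda>A. f ` P A)" "f ` H \<subseteq> \<Union>\<F>"
    using compactinD [OF comp [unfolded compact_space_def], of "range (\<lambda>A. f ` P A)"] top by metis
  obtain \<A> where \<A>: "finite \<A>" "\<F> = (\<lambda>A. f ` P A) ` \<A>"
    using finite_subset_image [OF \<F>(1,2)] by blast
  have "(\<lambda>h. inner_aut G h ` U) ` H \<subseteq> \<A>"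
  proof clarify
    fix h assume h: "h \<in> H"
    have "f h \<in> (\<Union>A\<in>\<A>. f ` P A)"
      using subsetD [OF \<F>(3) imageI [OF h]] by (simp only: \<A>(2))
    then obtain A where A: "A \<in> \<A>" "f h \<in> f ` P A"
      by (rule UN_E)
    have "h \<in> P A"
      using h A(2) by (rule P_f)
    then show "inner_aut G h ` U \<in> \<A>"
      using A(1) by (simp add: P_def)
  qed
  then have fin: "finite ((\<lambda>h. inner_aut G h ` U) ` H)"
    using \<A>(1) by (rule finite_subset)
  have ne: "H \<noteq> {}"
    using subgroup.one_closed [OF H] by auto
  define W where "W = (\<Inter>h\<in>H. inner_aut G h ` U)"
  have "open_subgroup G T W"
    unfolding W_def using fin ne Hcar compact_open_imp_open_subgroup [OF U]
    by (intro open_subgroup_finite_Inter) (auto intro: open_subgroup_inner_aut_image)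
  moreover have "W \<subseteq> U"
    using subgroup.one_closed [OF H] inner_aut_image_one [OF Ucar] by (auto simp: W_def)
  ultimately have Wco: "compact_open_subgroup G T W"
    by (intro compact_open_subgroup_open [OF U])
  have sub: "inner_aut G u ` U \<subseteq> carrier G" if "u \<in> H" for u
    using that Hcar Ucar by (intro inner_aut_image_subset) auto
  have W_subset: "inner_aut G w ` W \<subseteq> W" if w: "w \<in> H" for w
  proof -
    have wc: "w \<in> carrier G"
      using w Hcar by auto
    have "inner_aut G w x \<in> inner_aut G h ` U" if x: "x \<in> W" and h: "h \<in> H" for x h
    proof -
      have hc: "h \<in> carrier G"
        using h Hcar by auto
      \<comment> \<open>The conjugate indexed by \<open>h\<close> is the image under
        \<open>w\<close> of the one indexed by \<open>inv w \<otimes> h\<close>.\<close>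
      have "inv w \<otimes> h \<in> H"
        using w h subgroup.m_closed [OF H] subgroup.m_inv_closed [OF H] by blast
      then have "x \<in> inner_aut G (inv w \<otimes> h) ` U"
        using x by (auto simp: W_def)
      then have "inner_aut G w x \<in> inner_aut G w ` inner_aut G (inv w \<otimes> h) ` U"
        by (rule imageI)
      also have "\<dots> = inner_aut G (w \<otimes> (inv w \<otimes> h)) ` U"
        using wc hc Ucar by (simp add: inner_aut_image_mult [of w])
      also have "w \<otimes> (inv w \<otimes> h) = h"
        using wc hc by (simp add: m_assoc [symmetric])
      finally show ?thesis .
    qed
    then show ?thesis
      by (auto simp: W_def)
  qed
  have Wcar: "W \<subseteq> carrier G"
    using \<open>W \<subseteq> U\<close> Ucar by auto
  have "inner_aut G h ` W = W" if "h \<in> H" for h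
    using that Hcar Wcar subgroup.m_inv_closed [OF H] W_subset by (intro inner_aut_image_fixI) auto
  then have "normalized_by G H W"
    using Hcar by (simp add: normalized_by_iff [OF Wcar])
  with Wco show thesis
    by (rule that)
qed

text \<open>One element of \<open>K\<close> moving the tidy subgroup suffices: it gives a
  neighbourhood \<open>D\<close> of the identity inside every open subgroup normalized by
  \<open>H\<close>, so their intersection is open.\<close>

lemma open_Res:
  assumes JI: "\<And>U. compact_open_subgroup G T U \<Longrightarrow> just_infinite G T U"
    and H: "subgroup H G" and K: "cocompact_closed_subgroup G T H K" "flat_on G T K"
    and none: "\<not> (\<exists>U. compact_open_subgroup G T U \<and> normalized_by G H U)"
  shows "smallest_open_normalized G T H (Res G T H)"
proof -
  obtain U where U: "compact_open_subgroup G T U" "\<And>k. k \<in> K \<Longrightarrow> tidy G T (inner_aut G k) U"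
    using K(2) by (auto simp: flat_on_def)
  \<comment> \<open>If every element of \<open>K\<close> fixed \<open>U\<close>, cocompactness would
    produce a compact open subgroup normalized by \<open>H\<close>, against
    \<open>none\<close>.\<close>
  obtain k where k: "k \<in> K" "inner_aut G k ` U \<noteq> U"
    using cocompact_normalized_compact_open [OF H K(1) U(1)] none by metis
  have KH: "subgroup K (G\<lparr>carrier := H\<rparr>)"
    using K(1) by (auto simp: cocompact_closed_subgroup_def closed_subgroup_def)
  have Hcar: "H \<subseteq> carrier G"
    using H by (rule subgroup.subset)
  have kH: "k \<in> H"
    using k(1) subgroup.subset [OF KH] by auto
  then have kc: "k \<in> carrier G"
    using Hcar by auto
  have "U = tidy_plus G (inner_aut G k) U <#> tidy_minus G (inner_aut G k) U"
    using U(2) [OF k(1)] unfolding tidy_def by (rule conjunct1)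
  then obtain D where D: "openin T D" "\<one> \<in> D"
    "\<And>V. \<lbrakk>open_subgroup G T V; inner_aut G k ` V = V\<rbrakk> \<Longrightarrow> D \<subseteq> V"
    using ex_open_subset_invariant_open_subgroups [OF U(1) JI [OF U(1)] kc _ k(2)] by metis
  define \<V> where "\<V> = {V. open_subgroup G T V \<and> normalized_by G H V}"
  have V: "subgroup V G" "V \<subseteq> carrier G" "\<And>h. h \<in> H \<Longrightarrow> inner_aut G h ` V = V" if "V \<in> \<V>" for V
  proof -
    show "subgroup V G"
      using that by (simp add: \<V>_def open_subgroup_def)
    then show Vc: "V \<subseteq> carrier G"
      by (rule subgroup.subset)
    show "inner_aut G h ` V = V" if "h \<in> H" for h
      using that \<open>V \<in> \<V>\<close> by (simp add: \<V>_def normalized_by_iff [OF Vc])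
  qed
  have "carrier G \<in> \<V>"
    using openin_topspace [of T] subgroup_self inner_aut_image_self [OF subgroup_self] Hcar
    by (auto simp: \<V>_def open_subgroup_def topspace_eq_carrier normalized_by_iff subset_iff
        simp del: openin_topspace)
  then have ne: "\<V> \<noteq> {}"
    by auto
  have Res: "Res G T H = \<Inter>\<V>"
    by (simp add: Res_def \<V>_def)
  have sub: "subgroup (\<Inter>\<V>) G"
    using ne V(1) by (intro subgroups_Inter) auto
  have "D \<subseteq> \<Inter>\<V>"
    using D(3) V(3) [OF _ kH] by (intro Inter_greatest) (auto simp only: \<V>_def mem_Collect_eq)
  then have "open_subgroup G T (\<Inter>\<V>)"
    using sub D(1,2) by (intro open_subgroupI)
  moreover have "inner_aut G h ` \<Inter>\<V> = \<Inter>\<V>" if "h \<in> H" for h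
    using that Hcar ne V(2,3) by (intro inner_aut_image_Inter_fix) auto
  then have "normalized_by G H (\<Inter>\<V>)"
    using Hcar by (simp add: normalized_by_iff [OF subgroup.subset [OF sub]])
  ultimately show ?thesis
    by (auto simp: smallest_open_normalized_def Res \<V>_def)
qed

end

section \<open>The dichotomy\<close>

theorem corollary1p13:
  fixes G :: "('a, 'b) monoid_scheme" and T :: "'a topology" and H :: "'a set"
  assumes "topological_group G T"
    and "totally_disconnected_space T"
    and "locally_compact_space T"
    and "T \<noteq> discrete_topology (carrier G)"
    and "closed_subgroup G T H"
    and "compactly_generated G T H"
    and "\<exists>K. cocompact_closed_subgroup G T H K \<and> flat_on G T K"
    and "\<And>U. compact_open_subgroup G T U \<Longrightarrow> just_infinite G T U"
  shows "((\<exists>U. compact_open_subgroup G T U \<and> normalized_by G H U) \<longrightarrow>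
            neighbourhood_base_at \<one>\<^bsub>G\<^esub> (\<lambda>U. compact_open_subgroup G T U \<and> normalized_by G H U) T)
       \<and> (\<not> (\<exists>U. compact_open_subgroup G T U \<and> normalized_by G H U) \<longrightarrow>
            smallest_open_normalized G T H (Res G T H)
            \<and> (\<forall>R. smallest_open_normalized G T H R \<longrightarrow> R = Res G T H))"
proof (intro conjI impI)
  interpret topological_group G T by fact
  have H: "subgroup H G"
    using assms(5) by (simp add: closed_subgroup_def)
  show "neighbourhood_base_at \<one>\<^bsub>G\<^esub> (\<lambda>U. compact_open_subgroup G T U \<and> normalized_by G H U) T"
    if ex: "\<exists>U. compact_open_subgroup G T U \<and> normalized_by G H U"
  proof -
    obtain U where U: "compact_open_subgroup G T U" "normalized_by G H U"
      using ex by blast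
    show ?thesis
      by (rule normalized_compact_open_base [OF assms(4,2) _ H U]) (rule assms(8))
  qed
  assume none: "\<not> (\<exists>U. compact_open_subgroup G T U \<and> normalized_by G H U)"
  obtain K where "cocompact_closed_subgroup G T H K" "flat_on G T K"
    using assms(7) by blast
  with none show smallest: "smallest_open_normalized G T H (Res G T H)"
    by (intro open_Res [OF _ H]) (rule assms(8))
  show "\<forall>R. smallest_open_normalized G T H R \<longrightarrow> R = Res G T H"
    using smallest unfolding smallest_open_normalized_def by (meson subset_antisym)
qed

end
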